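(* Let $\alpha$ and $\beta$ be compositions with $\beta\subseteq\alpha$. Then \[\mathfrak S^*_{\alpha/\beta}=\sum_T x^T,\] where the sum is over all skew immaculate tableaux $T$ of shape $\alpha/\beta$, and \[\mathcal R\mathfrak S^*_{\alpha/\beta}=\sum_T x^T,\] where the sum is over all skew row-strict immaculate tableaux $T$ of shape $\alpha/\beta$.
   Context: Compositions have diagrams with $\alpha_i$ left-justified boxes in row $i$ (row 1 at bottom). $\beta\subseteq\alpha$ means $\ell(\beta)\le\ell(\alpha)$ and $\beta_j\le\alpha_j$ for $j\le\ell(\beta)$; $\alpha/\beta$ is the set of boxes of $\alpha$ not in $\beta$. A skew immaculate tableau of shape $\alpha/\beta$ is a filling of $\alpha/\beta$ by positive integers such that the entries in the first column of $\alpha$ (if any lie in $\alpha/\beta$) strictly increase bottom to top and rows weakly increase left to right; a skew row-strict immaculate tableau is a filling such that those first-column entries weakly increase bottom to top and rows strictly increase left to right. $x^T=\prod_ix_i^{\#\{i\text{'s in }T\}}$. $\mathrm{QSym}$ and $\mathrm{NSym}$ are dual via the pairing with $\langle\mathbf h_\alpha,M_\beta\rangle=\delta_{\alpha\beta}$ ($M_\beta$ monomial quasisymmetric functions, $\mathbf h_\alpha$ noncommutative complete homogeneous functions). $\mathfrak S^*_\alpha$ is the dual immaculate function (generating function of fillings of $\alpha$ with leftmost column strictly increasing upward and rows weakly increasing) and $\mathcal R\mathfrak S^*_\alpha$ the row-strict dual immaculate function (leftmost column weakly increasing upward, rows strictly increasing); $\mathfrak S_\alpha$, $\mathcal R\mathfrak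 S_\alpha$ are the dual bases of $\mathrm{NSym}$. Define $\mathfrak S^*_{\alpha/\beta}=\sum_\gamma\langle\mathfrak S_\beta\mathbf h_\gamma,\mathfrak S^*_\alpha\rangle M_\gamma$ and $\mathcal R\mathfrak S^*_{\alpha/\beta}=\sum_\gamma\langle\mathcal R\mathfrak S_\beta\mathbf h_\gamma,\mathcal R\mathfrak S^*_\alpha\rangle M_\gamma$, the sums over compositions $\gamma$ of $|\alpha|-|\beta|$. *)

theory Defs
  imports "HOL-Library.Poly_Mapping" "HOL-Library.FuncSet"
begin

section \<open>Compositions\<close>

typedef composition = "{xs :: nat list. 0 \<notin> set xs}"
  morphisms parts Composition
  by (rule exI[of _ "[]"]) simp

setup_lifting type_definition_composition

text \<open>Under concatenation compositions are the free monoid on the positive integers; it is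
  written additively because \<^type>\<open>poly_mapping\<close> forms monoid algebras over additive monoids.\<close>

instantiation composition :: monoid_add
begin
lift_definition zero_composition :: composition is "[]" by simp
lift_definition plus_composition :: "composition \<Rightarrow> composition \<Rightarrow> composition" is "(@)" by simp
instance by intro_classes (transfer, simp)+
end

definition len :: "composition \<Rightarrow> nat" where
  "len \<alpha> = length (parts \<alpha>)"

definition part :: "composition \<Rightarrow> nat \<Rightarrow> nat" where
  "part \<alpha> i = parts \<alpha> ! i"

definition weight :: "composition \<Rightarrow> nat" where
  "weight \<alpha> = sum_list (parts \<alpha>)"

definition contained :: "composition \<Rightarrow> composition \<Rightarrow> bool" where
  "contained \<beta> \<alpha> \<longleftrightarrow> len \<beta> \<le> len \<alpha> \<and> (\<forall>j<len \<beta>. part \<beta> j \<le> part \<alpha> j)"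

lemma part_pos: "i < len \<alpha> \<Longrightarrow> 0 < part \<alpha> i"
  using parts[of \<alpha>] unfolding len_def part_def by (metis gr0I mem_Collect_eq nth_mem)

lemma composition_eqI:
  assumes "len \<alpha> = len \<beta>" "\<And>i. i < len \<alpha> \<Longrightarrow> part \<alpha> i = part \<beta> i"
  shows "\<alpha> = \<beta>"
  using assms unfolding len_def part_def by (metis nth_equalityI parts_inject)

lemma finite_compositions: "finite {\<gamma>. weight \<gamma> = n}"
proof -
  have "parts \<gamma> \<in> {xs. set xs \<subseteq> {..n} \<and> length xs \<le> n}" if "weight \<gamma> = n" for \<gamma>
  proof -
    have le: "length xs \<le> sum_list xs" if "0 \<notin> set xs" for xs :: "nat list"
      using that by (induction xs) auto
    have "0 \<notin> set (parts \<gamma>)" using parts[of \<gamma>] by simp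
    then show ?thesis
      using that le[of "parts \<gamma>"] member_le_sum_list[of _ "parts \<gamma>"]
      unfolding weight_def by auto
  qed
  then have "parts ` {\<gamma>. weight \<gamma> = n} \<subseteq> {xs. set xs \<subseteq> {..n} \<and> length xs \<le> n}" by blast
  then have "finite (parts ` {\<gamma>. weight \<gamma> = n})"
    by (rule finite_subset) (rule finite_lists_length_le, simp)
  then show ?thesis
    by (rule finite_imageD) (simp add: inj_on_def parts_inject)
qed


section \<open>Quasisymmetric functions\<close>

text \<open>A formal power series in \<open>x\<^sub>1, x\<^sub>2, \<dots>\<close> is given by its coefficients, a monomial by its
  exponents. The exponent at index 0 is not used.\<close>

type_synonym 'a series = "(nat \<Rightarrow>\<^sub>0 nat) \<Rightarrow> 'a"

text \<open>The monomial with exponent \<open>\<alpha>\<^sub>j\<close> at the variable \<open>is ! j\<close>.\<close>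

definition placed :: "nat list \<Rightarrow> composition \<Rightarrow> nat \<Rightarrow>\<^sub>0 nat" where
  "placed is \<alpha> = (\<Sum>j<len \<alpha>. Poly_Mapping.single (is ! j) (part \<alpha> j))"

definition index_seqs :: "nat \<Rightarrow> nat list set" where
  "index_seqs k = {is. length is = k \<and> sorted_wrt (<) is \<and> 0 \<notin> set is}"

definition monomial_qsym :: "composition \<Rightarrow> 'a::comm_ring_1 series" where
  "monomial_qsym \<alpha> m = of_nat (card {is \<in> index_seqs (len \<alpha>). placed is \<alpha> = m})"

text \<open>The linear combination of the monomial functions with coefficients \<open>c\<close>.\<close>

definition monomial_combination :: "(composition \<Rightarrow>\<^sub>0 'a::comm_ring_1) \<Rightarrow> 'a series" where
  "monomial_combination c m =
     (\<Sum>\<alpha>\<in>Poly_Mapping.keys c. Poly_Mapping.lookup c \<alpha> * monomial_qsym \<alpha> m)"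

definition QSym :: "'a::comm_ring_1 series set" where
  "QSym = range monomial_combination"

lemma lookup_placed:
  assumes "is \<in> index_seqs (len \<alpha>)" "j < len \<alpha>"
  shows "Poly_Mapping.lookup (placed is \<alpha>) (is ! j) = part \<alpha> j"
proof -
  have d: "distinct is" and l: "length is = len \<alpha>"
    using assms(1) strict_sorted_iff unfolding index_seqs_def by auto
  have "Poly_Mapping.lookup (placed is \<alpha>) (is ! j)
      = (\<Sum>i<len \<alpha>. if i = j then part \<alpha> i else 0)"
    unfolding placed_def lookup_sum
    by (rule sum.cong) (use d l assms(2) in \<open>auto simp: lookup_single when_def nth_eq_iff_index_eq\<close>)
  then show ?thesis using assms(2) by simp
qed

lemma keys_placed:
  assumes "is \<in> index_seqs (len \<alpha>)"
  shows "Poly_Mapping.keys (placed is \<alpha>) = set is"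
proof
  show "Poly_Mapping.keys (placed is \<alpha>) \<subseteq> set is"
  proof
    fix x assume "x \<in> Poly_Mapping.keys (placed is \<alpha>)"
    then have "(\<Sum>j<len \<alpha>. Poly_Mapping.lookup (Poly_Mapping.single (is ! j) (part \<alpha> j)) x) \<noteq> 0"
      by (simp add: placed_def in_keys_iff lookup_sum)
    then obtain j where "j < len \<alpha>" "Poly_Mapping.lookup (Poly_Mapping.single (is ! j) (part \<alpha> j)) x \<noteq> 0"
      by (meson lessThan_iff sum.neutral)
    then show "x \<in> set is"
      using assms by (auto simp: lookup_single when_def index_seqs_def split: if_splits)
  qed
  show "set is \<subseteq> Poly_Mapping.keys (placed is \<alpha>)"
  proof
    fix x assume "x \<in> set is"
    then obtain j where j: "j < len \<alpha>" "x = is ! j"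
      using assms by (auto simp: in_set_conv_nth index_seqs_def)
    then show "x \<in> Poly_Mapping.keys (placed is \<alpha>)"
      using lookup_placed[OF assms j(1)] part_pos[OF j(1)] by (simp add: in_keys_iff)
  qed
qed

lemma placed_inj:
  assumes "is \<in> index_seqs (len \<alpha>)" "js \<in> index_seqs (len \<beta>)" "placed is \<alpha> = placed js \<beta>"
  shows "is = js \<and> \<alpha> = \<beta>"
proof -
  have "set is = set js" using keys_placed assms by metis
  then have ij: "is = js"
    using assms(1,2) unfolding index_seqs_def
    by (auto intro: sorted_distinct_set_unique simp: strict_sorted_iff)
  then have l: "len \<alpha> = len \<beta>" using assms(1,2) unfolding index_seqs_def by auto
  show ?thesis
    using ij composition_eqI[OF l] lookup_placed assms l by metis
qed

lemma upt_in_index_seqs: "[1..<Suc k] \<in> index_seqs k"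
  unfolding index_seqs_def by (auto simp del: upt_Suc)

lemma monomial_qsym_packed:
  "monomial_qsym \<beta> (placed [1..<Suc (len \<alpha>)] \<alpha>) = (if \<alpha> = \<beta> then 1 else (0::'a::comm_ring_1))"
proof -
  let ?S = "{is \<in> index_seqs (len \<beta>). placed is \<beta> = placed [1..<Suc (len \<alpha>)] \<alpha>}"
  have "?S = (if \<alpha> = \<beta> then {[1..<Suc (len \<alpha>)]} else {})"
    using placed_inj[OF _ upt_in_index_seqs, of _ \<beta> \<alpha>] upt_in_index_seqs[of "len \<alpha>"] by auto
  then show ?thesis by (simp add: monomial_qsym_def del: upt_Suc)
qed

lemma monomial_combination_packed:
  "monomial_combination c (placed [1..<Suc (len \<alpha>)] \<alpha>) = Poly_Mapping.lookup c \<alpha>"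
proof -
  have "monomial_combination c (placed [1..<Suc (len \<alpha>)] \<alpha>)
      = (\<Sum>\<beta>\<in>Poly_Mapping.keys c. if \<beta> = \<alpha> then Poly_Mapping.lookup c \<beta> else 0)"
    unfolding monomial_combination_def
    by (rule sum.cong) (auto simp: monomial_qsym_packed simp del: upt_Suc One_nat_def)
  then show ?thesis by (simp add: in_keys_iff)
qed

lemma inj_monomial_combination: "inj monomial_combination"
  by (rule injI, rule poly_mapping_eqI) (metis monomial_combination_packed)

lemma monomial_combination_single: "monomial_combination (Poly_Mapping.single \<alpha> 1) = monomial_qsym \<alpha>"
  by (rule ext) (simp add: monomial_combination_def)


section \<open>Noncommutative symmetric functions and the pairing\<close>

text \<open>The algebra freely generated by \<open>h\<^sub>1, h\<^sub>2, \<dots>\<close>, i.e. the monoid algebra of compositions;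
  its product is the convolution product of \<^type>\<open>poly_mapping\<close>.\<close>

type_synonym 'a nsym = "composition \<Rightarrow>\<^sub>0 'a"

definition complete :: "composition \<Rightarrow> 'a::comm_ring_1 nsym" where
  "complete \<alpha> = Poly_Mapping.single \<alpha> 1"

lemma complete_mult: "complete \<alpha> * complete \<beta> = complete (\<alpha> + \<beta>)"
  by (simp add: complete_def mult_single)

text \<open>The coefficients of a quasisymmetric function in the monomial basis; by
  \<open>inj_monomial_combination\<close> they are unique. Nothing is claimed outside \<^const>\<open>QSym\<close>.\<close>

definition monomial_coeffs :: "'a::comm_ring_1 series \<Rightarrow> (composition \<Rightarrow>\<^sub>0 'a)" where
  "monomial_coeffs = inv monomial_combination"

lemma monomial_combination_coeffs: "g \<in> QSym \<Longrightarrow> monomial_combination (monomial_coeffs g) = g"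
  unfolding QSym_def monomial_coeffs_def by (rule f_inv_into_f)

text \<open>The bilinear extension of \<open>\<langle>h\<^sub>\<alpha>, M\<^sub>\<beta>\<rangle> = \<delta>\<^sub>\<alpha>\<^sub>\<beta>\<close>.\<close>

definition pairing :: "'a::comm_ring_1 nsym \<Rightarrow> 'a series \<Rightarrow> 'a" where
  "pairing f g = (\<Sum>\<alpha>\<in>Poly_Mapping.keys f.
     Poly_Mapping.lookup f \<alpha> * Poly_Mapping.lookup (monomial_coeffs g) \<alpha>)"

lemma pairing_complete_monomial:
  "pairing (complete \<alpha>) (monomial_qsym \<beta>) = (if \<alpha> = \<beta> then 1 else (0::'a::comm_ring_1))"
proof -
  have "monomial_coeffs (monomial_qsym \<beta>) = Poly_Mapping.single \<beta> (1::'a)"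
    unfolding monomial_coeffs_def monomial_combination_single[symmetric]
    by (rule inv_f_f[OF inj_monomial_combination])
  then show ?thesis by (auto simp: pairing_def complete_def lookup_single)
qed

text \<open>The basis of NSym dual to a basis \<open>B\<close> of QSym.\<close>

definition dual_basis :: "(composition \<Rightarrow> 'a::comm_ring_1 series) \<Rightarrow> composition \<Rightarrow> 'a nsym" where
  "dual_basis B \<alpha> = (THE f. \<forall>\<gamma>. pairing f (B \<gamma>) = (if \<alpha> = \<gamma> then 1 else 0))"


section \<open>Diagrams and tableaux\<close>

text \<open>Cells are pairs (row, column), both counted from 0, with row 0 at the bottom. Fillings
  take the value \<^const>\<open>undefined\<close> outside the diagram, so that each is counted once.\<close>

definition diagram :: "composition \<Rightarrow> (nat \<times> nat) set" where
  "diagram \<alpha> = {(i, j). i < len \<alpha> \<and> j < part \<alpha> i}"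

definition skew_diagram :: "composition \<Rightarrow> composition \<Rightarrow> (nat \<times> nat) set" where
  "skew_diagram \<alpha> \<beta> = diagram \<alpha> - diagram \<beta>"

definition fillings :: "(nat \<times> nat) set \<Rightarrow> (nat \<times> nat \<Rightarrow> nat) set" where
  "fillings D = D \<rightarrow>\<^sub>E {0<..}"

definition immaculate_tableaux :: "(nat \<times> nat) set \<Rightarrow> (nat \<times> nat \<Rightarrow> nat) set" where
  "immaculate_tableaux D = {T \<in> fillings D.
     (\<forall>i i'. (i, 0) \<in> D \<and> (i', 0) \<in> D \<and> i < i' \<longrightarrow> T (i, 0) < T (i', 0)) \<and>
     (\<forall>i j j'. (i, j) \<in> D \<and> (i, j') \<in> D \<and> j < j' \<longrightarrow> T (i, j) \<le> T (i, j'))}"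

definition row_strict_immaculate_tableaux :: "(nat \<times> nat) set \<Rightarrow> (nat \<times> nat \<Rightarrow> nat) set" where
  "row_strict_immaculate_tableaux D = {T \<in> fillings D.
     (\<forall>i i'. (i, 0) \<in> D \<and> (i', 0) \<in> D \<and> i < i' \<longrightarrow> T (i, 0) \<le> T (i', 0)) \<and>
     (\<forall>i j j'. (i, j) \<in> D \<and> (i, j') \<in> D \<and> j < j' \<longrightarrow> T (i, j) < T (i, j'))}"

text \<open>The exponents of \<open>x\<^sup>T\<close>.\<close>

definition content :: "(nat \<times> nat) set \<Rightarrow> (nat \<times> nat \<Rightarrow> nat) \<Rightarrow> nat \<Rightarrow>\<^sub>0 nat" where
  "content D T = (\<Sum>c\<in>D. Poly_Mapping.single (T c) 1)"

text \<open>The power series \<open>\<Sum>\<^sub>T x\<^sup>T\<close>, the sum being over the fillings \<open>T\<close> of \<open>D\<close> in \<open>X\<close>.\<close>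

definition tableau_series ::
    "(nat \<times> nat) set \<Rightarrow> (nat \<times> nat \<Rightarrow> nat) set \<Rightarrow> 'a::comm_ring_1 series" where
  "tableau_series D X m = of_nat (card {T \<in> X. content D T = m})"

lemma finite_diagram: "finite (diagram \<alpha>)"
proof -
  have "diagram \<alpha> = Sigma {..<len \<alpha>} (\<lambda>i. {..<part \<alpha> i})" by (auto simp: diagram_def)
  then show ?thesis by simp
qed

lemma lookup_content:
  "finite D \<Longrightarrow> Poly_Mapping.lookup (content D T) i = card {c \<in> D. T c = i}"
  by (simp add: content_def lookup_sum lookup_single when_def sum.If_cases Int_def)

lemma finite_content_fibre:
  assumes "finite D" "X \<subseteq> fillings D"
  shows "finite {T \<in> X. content D T = m}"
proof (rule finite_subset)
  show "{T \<in> X. content D T = m} \<subseteq> D \<rightarrow>\<^sub>E Poly_Mapping.keys m"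
  proof
    fix T assume T: "T \<in> {T \<in> X. content D T = m}"
    have "T c \<in> Poly_Mapping.keys m" if "c \<in> D" for c
    proof -
      have "c \<in> {c' \<in> D. T c' = T c}" using that by simp
      moreover have "finite {c' \<in> D. T c' = T c}" using assms(1) by simp
      ultimately have "card {c' \<in> D. T c' = T c} \<noteq> 0" by (metis card_0_eq empty_iff)
      then show ?thesis using T lookup_content[OF assms(1), of T] by (auto simp: in_keys_iff)
    qed
    then show "T \<in> D \<rightarrow>\<^sub>E Poly_Mapping.keys m"
      using T assms(2) by (auto simp: fillings_def PiE_iff)
  qed
  show "finite (D \<rightarrow>\<^sub>E Poly_Mapping.keys m)"
    using assms(1) by (intro finite_PiE) auto
qed


section \<open>Immaculate functions\<close>

definition dual_immaculate :: "composition \<Rightarrow> 'a::comm_ring_1 series" where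
  "dual_immaculate \<alpha> = tableau_series (diagram \<alpha>) (immaculate_tableaux (diagram \<alpha>))"

definition row_strict_dual_immaculate :: "composition \<Rightarrow> 'a::comm_ring_1 series" where
  "row_strict_dual_immaculate \<alpha> =
     tableau_series (diagram \<alpha>) (row_strict_immaculate_tableaux (diagram \<alpha>))"

definition immaculate :: "composition \<Rightarrow> 'a::comm_ring_1 nsym" where
  "immaculate = dual_basis dual_immaculate"

definition row_strict_immaculate :: "composition \<Rightarrow> 'a::comm_ring_1 nsym" where
  "row_strict_immaculate = dual_basis row_strict_dual_immaculate"

definition skew_dual_immaculate :: "composition \<Rightarrow> composition \<Rightarrow> 'a::comm_ring_1 series" where
  "skew_dual_immaculate \<alpha> \<beta> m =
     (\<Sum>\<gamma> | weight \<gamma> = weight \<alpha> - weight \<beta>.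
        pairing (immaculate \<beta> * complete \<gamma>) (dual_immaculate \<alpha>) * monomial_qsym \<gamma> m)"

definition skew_row_strict_dual_immaculate ::
    "composition \<Rightarrow> composition \<Rightarrow> 'a::comm_ring_1 series" where
  "skew_row_strict_dual_immaculate \<alpha> \<beta> m =
     (\<Sum>\<gamma> | weight \<gamma> = weight \<alpha> - weight \<beta>.
        pairing (row_strict_immaculate \<beta> * complete \<gamma>) (row_strict_dual_immaculate \<alpha>)
          * monomial_qsym \<gamma> m)"

end

theory Submission
  imports Defs
begin

text \<open>The cells of a tableau carrying its largest letter form a \<open>strip\<close>; so tableaux of shape
  \<open>\<alpha>/\<beta>\<close> and content \<open>\<gamma>\<close> are counted by chains of strips from \<open>\<beta>\<close> to \<open>\<alpha>\<close>, for each choice of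
  increasing variables. With \<open>H\<^sub>n\<close> the operator that adds a strip of size \<open>n\<close>, this says that
  \<open>\<langle>f h\<^sub>\<gamma>, B\<^sub>\<alpha>\<rangle>\<close> is obtained from \<open>\<alpha> \<mapsto> \<langle>f, B\<^sub>\<alpha>\<rangle>\<close> by applying the operators \<open>H\<^sub>n\<close> for the parts \<open>n\<close>
  of \<open>\<gamma>\<close>; taking for \<open>f\<close> the dual basis element of \<open>\<beta>\<close> yields the chains of strips from \<open>\<beta>\<close>.

  It remains to see that the dual bases exist, i.e. that \<open>f \<mapsto> (\<alpha> \<mapsto> \<langle>f, B\<^sub>\<alpha>\<rangle>)\<close> is bijective. For
  immaculate tableaux this is a triangularity argument. The row-strict matrix is not triangular;
  instead, writing \<open>H\<close> and \<open>X\<close> for the row-strict and the ordinary operators, a sign-reversing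
  involution gives \<open>\<Sum>\<^sub>k (-1)\<^sup>k X\<^sub>n\<^sub>-\<^sub>k H\<^sub>k = 0\<close> for \<open>n > 0\<close>, which carries bijectivity over from \<open>X\<close> to \<open>H\<close>.\<close>


section \<open>Compositions as row lengths\<close>

text \<open>Padding with zeros turns equality and containment into pointwise statements about total
  functions, with no case distinction on lengths.\<close>

definition rowlen :: "composition \<Rightarrow> nat \<Rightarrow> nat" where
  "rowlen \<alpha> i = (if i < len \<alpha> then part \<alpha> i else 0)"

lemma rowlen_pos_iff: "0 < rowlen \<alpha> i \<longleftrightarrow> i < len \<alpha>"
  by (auto simp: rowlen_def part_pos)

lemma rowlen_eqI:
  assumes "\<And>i. rowlen \<alpha> i = rowlen \<beta> i"
  shows "\<alpha> = \<beta>"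
proof (rule composition_eqI)
  have "i < len \<alpha> \<longleftrightarrow> i < len \<beta>" for i
    using assms rowlen_pos_iff by metis
  then show l: "len \<alpha> = len \<beta>"
    by (metis linorder_neqE_nat less_irrefl)
  show "part \<alpha> i = part \<beta> i" if "i < len \<alpha>" for i
    using assms[of i] that l by (simp add: rowlen_def)
qed

lemma ex_composition_rowlen:
  assumes "\<And>i. 0 < f i \<longleftrightarrow> i < n"
  shows "\<exists>\<alpha>. rowlen \<alpha> = f"
proof -
  have "f i \<noteq> 0" if "i < n" for i
    using assms that by simp
  then have "0 \<notin> f ` {0..<n}"
    by force
  then have p: "parts (Composition (map f [0..<n])) = map f [0..<n]"
    by (intro Composition_inverse) simp
  have "rowlen (Composition (map f [0..<n])) = f"
    using assms by (auto simp: rowlen_def len_def part_def p fun_eq_iff)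
  then show ?thesis by blast
qed

lemma contained_iff: "contained \<beta> \<alpha> \<longleftrightarrow> (\<forall>i. rowlen \<beta> i \<le> rowlen \<alpha> i)"
proof
  assume "contained \<beta> \<alpha>"
  then show "\<forall>i. rowlen \<beta> i \<le> rowlen \<alpha> i"
    by (auto simp: contained_def rowlen_def)
next
  assume r: "\<forall>i. rowlen \<beta> i \<le> rowlen \<alpha> i"
  have l: "i < len \<alpha>" if "i < len \<beta>" for i
    using r that by (metis rowlen_pos_iff less_le_trans)
  then have "len \<beta> \<le> len \<alpha>"
    by (meson less_irrefl not_le)
  moreover have "part \<beta> i \<le> part \<alpha> i" if "i < len \<beta>" for i
    using r[rule_format, of i] that l[OF that] by (simp add: rowlen_def)
  ultimately show "contained \<beta> \<alpha>"
    by (simp add: contained_def)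
qed

lemma contained_refl [simp]: "contained \<alpha> \<alpha>"
  by (simp add: contained_iff)

lemma contained_trans: "contained \<alpha> \<beta> \<Longrightarrow> contained \<beta> \<gamma> \<Longrightarrow> contained \<alpha> \<gamma>"
  by (auto simp: contained_iff intro: le_trans)

lemma contained_len: "contained \<beta> \<alpha> \<Longrightarrow> len \<beta> \<le> len \<alpha>"
  by (simp add: contained_def)

lemma weight_rowlen: "weight \<alpha> = (\<Sum>i<len \<alpha>. rowlen \<alpha> i)"
  by (simp add: weight_def rowlen_def sum_list_sum_nth len_def part_def atLeast0LessThan)

lemma weight_rowlen':
  assumes "len \<alpha> \<le> n"
  shows "weight \<alpha> = (\<Sum>i<n. rowlen \<alpha> i)"
  unfolding weight_rowlen using assms
  by (intro sum.mono_neutral_left) (auto simp: rowlen_def)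

lemma contained_weight:
  assumes "contained \<beta> \<alpha>"
  shows "weight \<beta> \<le> weight \<alpha>"
  unfolding weight_rowlen[of \<alpha>] weight_rowlen'[OF contained_len[OF assms]]
  using assms by (intro sum_mono) (simp add: contained_iff)

lemma contained_weight_eq:
  assumes "contained \<beta> \<alpha>" "weight \<beta> = weight \<alpha>"
  shows "\<beta> = \<alpha>"
proof (rule ccontr)
  assume "\<beta> \<noteq> \<alpha>"
  then obtain i where i: "rowlen \<beta> i < rowlen \<alpha> i"
    using assms(1) rowlen_eqI by (metis contained_iff le_neq_implies_less)
  then have "i < len \<alpha>"
    by (metis rowlen_pos_iff gr_zeroI not_less0)
  then have "(\<Sum>i<len \<alpha>. rowlen \<beta> i) < (\<Sum>i<len \<alpha>. rowlen \<alpha> i)"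
    using assms(1) i by (intro sum_strict_mono_ex1) (auto simp: contained_iff)
  then show False
    using assms(2) weight_rowlen[of \<alpha>] weight_rowlen'[OF contained_len[OF assms(1)]] by simp
qed

lemma len_le_weight: "len \<alpha> \<le> weight \<alpha>"
proof -
  have "(\<Sum>i<len \<alpha>. 1) \<le> (\<Sum>i<len \<alpha>. rowlen \<alpha> i)"
    by (intro sum_mono) (simp add: Suc_le_eq rowlen_pos_iff)
  then show ?thesis by (simp add: weight_rowlen)
qed

section \<open>Concatenation and the last part of a composition\<close>

lemma parts_zero [simp]: "parts 0 = []"
  by (rule zero_composition.rep_eq)

lemma parts_plus [simp]: "parts (\<alpha> + \<beta>) = parts \<alpha> @ parts \<beta>"
  by (rule plus_composition.rep_eq)

lemma weight_zero [simp]: "weight 0 = 0"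
  by (simp add: weight_def)

lemma weight_plus [simp]: "weight (\<alpha> + \<beta>) = weight \<alpha> + weight \<beta>"
  by (simp add: weight_def)

lemma len_zero [simp]: "len 0 = 0"
  by (simp add: len_def)

lemma len_plus [simp]: "len (\<alpha> + \<beta>) = len \<alpha> + len \<beta>"
  by (simp add: len_def)

lemma contained_zero [simp]: "contained 0 \<alpha>"
  by (simp add: contained_def)

lemma weight_eq_0_iff [simp]: "weight \<alpha> = 0 \<longleftrightarrow> \<alpha> = 0"
  using contained_weight_eq[of 0 \<alpha>] by auto

lemma len_eq_0_iff [simp]: "len \<alpha> = 0 \<longleftrightarrow> \<alpha> = 0"
  by (auto intro: composition_eqI)

definition single_row :: "nat \<Rightarrow> composition" where
  "single_row n = Composition [n]"

lemma parts_single_row [simp]: "0 < n \<Longrightarrow> parts (single_row n) = [n]"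
  unfolding single_row_def by (rule Composition_inverse) simp

lemma weight_single_row [simp]: "0 < n \<Longrightarrow> weight (single_row n) = n"
  by (simp add: weight_def)

lemma len_single_row [simp]: "0 < n \<Longrightarrow> len (single_row n) = 1"
  by (simp add: len_def)

lemma rowlen_snoc:
  assumes "0 < n"
  shows "rowlen (\<beta> + single_row n) i = (if i = len \<beta> then n else rowlen \<beta> i)"
  using assms by (auto simp: rowlen_def part_def len_def nth_append)

lemma composition_snoc_cases [case_names zero snoc]:
  obtains "\<alpha> = 0" | \<beta> n where "0 < n" "\<alpha> = \<beta> + single_row n"
proof (cases "parts \<alpha>" rule: rev_cases)
  case Nil
  then have "\<alpha> = 0" by (simp add: parts_inject[symmetric])
  then show ?thesis using that(1) by blast
next
  case (snoc xs n)
  have z: "0 \<notin> set xs" "0 < n"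
    using parts[of \<alpha>] snoc by auto
  then have "parts (Composition xs) = xs"
    by (intro Composition_inverse) simp
  then have "\<alpha> = Composition xs + single_row n"
    using z snoc by (simp add: parts_inject[symmetric])
  then show ?thesis using that(2) z by blast
qed

text \<open>Peeling from the right fits \<open>fold (grow p) (parts \<gamma>)\<close>, where the
  last part acts last, and tableaux, where the last part counts the largest letter.\<close>

lemma composition_snoc_induct [case_names zero snoc]:
  assumes "P 0" "\<And>\<beta> n. 0 < n \<Longrightarrow> P \<beta> \<Longrightarrow> P (\<beta> + single_row n)"
  shows "P \<alpha>"
proof (induction "len \<alpha>" arbitrary: \<alpha> rule: less_induct)
  case less
  show ?case
    by (cases \<alpha> rule: composition_snoc_cases) (use assms less in auto)
qed

lemma snoc_eq_iff:
  assumes "0 < m" "0 < n"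
  shows "\<beta> + single_row m = \<gamma> + single_row n \<longleftrightarrow> \<beta> = \<gamma> \<and> m = n"
  using assms by (auto simp: parts_inject[symmetric])


section \<open>Diagrams\<close>

lemma mem_diagram: "(i, j) \<in> diagram \<alpha> \<longleftrightarrow> j < rowlen \<alpha> i"
  by (auto simp: diagram_def rowlen_def)

lemma contained_iff_diagram: "contained \<beta> \<alpha> \<longleftrightarrow> diagram \<beta> \<subseteq> diagram \<alpha>"
proof
  assume "diagram \<beta> \<subseteq> diagram \<alpha>"
  then show "contained \<beta> \<alpha>"
    unfolding contained_iff subset_iff by (metis mem_diagram not_le less_irrefl)
qed (auto simp: contained_iff mem_diagram, meson less_le_trans)

lemma diagram_inject: "diagram \<alpha> = diagram \<beta> \<longleftrightarrow> \<alpha> = \<beta>"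
proof
  assume "diagram \<alpha> = diagram \<beta>"
  then have "contained \<alpha> \<beta>" "contained \<beta> \<alpha>"
    by (auto simp: contained_iff_diagram)
  then show "\<alpha> = \<beta>"
    by (intro rowlen_eqI) (simp add: contained_iff antisym)
qed simp

lemma card_diagram: "card (diagram \<alpha>) = weight \<alpha>"
proof -
  have "diagram \<alpha> = Sigma {..<len \<alpha>} (\<lambda>i. {..<part \<alpha> i})"
    by (auto simp: diagram_def)
  then show ?thesis
    by (simp add: weight_rowlen rowlen_def)
qed

lemma initial_segment:
  fixes A :: "nat set"
  assumes "finite A" "\<And>i j. i \<in> A \<Longrightarrow> j \<le> i \<Longrightarrow> j \<in> A"
  shows "A = {..<card A}"
proof (cases "A = {}")
  case False
  have "A = {..Max A}"
    using assms False by (auto intro: Max_in)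
  then have "A = {..<Suc (Max A)}"
    by (simp only: lessThan_Suc_atMost)
  then show ?thesis by (metis card_lessThan)
qed simp

text \<open>Rows must be closed to the left, but only the first column downwards: the other columns
  of a composition carry no condition. This is why order conditions on rows and on the first column
  suffice in \<open>tableaux_cut\<close>.\<close>

lemma ex_diagram:
  assumes fin: "finite D"
    and left: "\<And>i j j'. (i, j) \<in> D \<Longrightarrow> j' \<le> j \<Longrightarrow> (i, j') \<in> D"
    and down: "\<And>i i'. (i, 0) \<in> D \<Longrightarrow> i' \<le> i \<Longrightarrow> (i', 0) \<in> D"
  shows "\<exists>\<alpha>. diagram \<alpha> = D"
proof -
  define f where "f i = card {j. (i, j) \<in> D}" for i
  have fin_row: "finite {j. (i, j) \<in> D}" for i
    by (rule finite_subset[of _ "snd ` D"]) (use fin in \<open>force+\<close>)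
  have row: "{j. (i, j) \<in> D} = {..<f i}" for i
    unfolding f_def by (rule initial_segment[OF fin_row]) (use left in blast)
  have fin_col: "finite {i. (i, 0) \<in> D}"
    by (rule finite_subset[of _ "fst ` D"]) (use fin in \<open>force+\<close>)
  have col: "{i. (i, 0) \<in> D} = {..<card {i. (i, 0) \<in> D}}"
    by (rule initial_segment[OF fin_col]) (use down in blast)
  \<comment> \<open>By left closure a row is nonempty exactly when it meets column 0.\<close>
  have "0 < f i \<longleftrightarrow> i < card {i. (i, 0) \<in> D}" for i
    using row[of i] col by auto
  then obtain \<alpha> where "rowlen \<alpha> = f"
    using ex_composition_rowlen by blast
  moreover have "(i, j) \<in> D \<longleftrightarrow> j < f i" for i j
    using row[of i] by blast
  ultimately have "diagram \<alpha> = D"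
    by (auto simp: mem_diagram)
  then show ?thesis by blast
qed

lemma finite_skew_diagram: "finite (skew_diagram \<alpha> \<beta>)"
  by (simp add: skew_diagram_def finite_diagram)

lemma card_skew_diagram: "contained \<beta> \<alpha> \<Longrightarrow> card (skew_diagram \<alpha> \<beta>) = weight \<alpha> - weight \<beta>"
  by (simp add: skew_diagram_def card_Diff_subset finite_diagram card_diagram contained_iff_diagram)

lemma mem_skew_diagram: "(i, j) \<in> skew_diagram \<alpha> \<beta> \<longleftrightarrow> rowlen \<beta> i \<le> j \<and> j < rowlen \<alpha> i"
  by (auto simp: skew_diagram_def mem_diagram)


section \<open>Splitting off the largest letter\<close>

text \<open>Immaculate tableaux if \<open>p\<close> is false, row-strict ones if \<open>p\<close> is true.\<close>

definition tableaux :: "bool \<Rightarrow> (nat \<times> nat) set \<Rightarrow> (nat \<times> nat \<Rightarrow> nat) set" where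
  "tableaux p D = {T \<in> fillings D.
     (\<forall>i i'. (i, 0) \<in> D \<and> (i', 0) \<in> D \<and> i < i' \<longrightarrow>
        T (i, 0) < T (i', 0) \<or> p \<and> T (i, 0) = T (i', 0)) \<and>
     (\<forall>i j j'. (i, j) \<in> D \<and> (i, j') \<in> D \<and> j < j' \<longrightarrow>
        T (i, j) < T (i, j') \<or> \<not> p \<and> T (i, j) = T (i, j'))}"

lemma immaculate_tableaux_eq: "immaculate_tableaux D = tableaux False D"
  unfolding immaculate_tableaux_def tableaux_def le_less by simp

lemma row_strict_immaculate_tableaux_eq: "row_strict_immaculate_tableaux D = tableaux True D"
  unfolding row_strict_immaculate_tableaux_def tableaux_def le_less by simp

text \<open>The condition for the cells of \<open>\<alpha>/\<mu>\<close> to carry the same letter.\<close>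

definition strip :: "bool \<Rightarrow> composition \<Rightarrow> composition \<Rightarrow> bool" where
  "strip p \<mu> \<alpha> \<longleftrightarrow> contained \<mu> \<alpha> \<and>
     (if p then \<forall>i. rowlen \<alpha> i \<le> Suc (rowlen \<mu> i) else len \<alpha> \<le> Suc (len \<mu>))"

lemma strip_contained: "strip p \<mu> \<alpha> \<Longrightarrow> contained \<mu> \<alpha>"
  by (simp add: strip_def)

lemma mem_skew_diagram_col0: "(i, 0) \<in> skew_diagram \<alpha> \<mu> \<longleftrightarrow> len \<mu> \<le> i \<and> i < len \<alpha>"
  using rowlen_pos_iff[of \<mu> i] rowlen_pos_iff[of \<alpha> i] by (auto simp: mem_skew_diagram)

text \<open>This restates \<open>strip\<close> in the format of \<open>tableaux\<close>: a constant
  filling turns every comparison into an equality, which the first column allows only if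
  \<open>p\<close> holds and the rows only if it does not.\<close>

lemma strip_iff:
  "strip p \<mu> \<alpha> \<longleftrightarrow> contained \<mu> \<alpha> \<and>
     (\<forall>i i'. (i, 0) \<in> skew_diagram \<alpha> \<mu> \<and> (i', 0) \<in> skew_diagram \<alpha> \<mu> \<and> i < i' \<longrightarrow> p) \<and>
     (\<forall>i j j'. (i, j) \<in> skew_diagram \<alpha> \<mu> \<and> (i, j') \<in> skew_diagram \<alpha> \<mu> \<and> j < j' \<longrightarrow> \<not> p)"
proof (cases p)
  case True
  have "(\<forall>i. rowlen \<alpha> i \<le> Suc (rowlen \<mu> i)) \<longleftrightarrow>
    (\<forall>i j j'. (i, j) \<in> skew_diagram \<alpha> \<mu> \<and> (i, j') \<in> skew_diagram \<alpha> \<mu> \<and> j < j' \<longrightarrow> False)"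
    (is "?L \<longleftrightarrow> ?R")
  proof
    assume ?L
    show ?R
    proof (intro allI impI)
      fix i j j'
      assume "(i, j) \<in> skew_diagram \<alpha> \<mu> \<and> (i, j') \<in> skew_diagram \<alpha> \<mu> \<and> j < j'"
      with \<open>?L\<close>[rule_format, of i] show False by (auto simp: mem_skew_diagram)
    qed
  next
    assume R: ?R
    show ?L
    proof (rule allI, rule ccontr)
      fix i assume "\<not> rowlen \<alpha> i \<le> Suc (rowlen \<mu> i)"
      then show False
        using R[rule_format, of i "rowlen \<mu> i" "Suc (rowlen \<mu> i)"] by (simp add: mem_skew_diagram)
    qed
  qed
  with True show ?thesis by (simp add: strip_def)
next
  case False
  have "len \<alpha> \<le> Suc (len \<mu>) \<longleftrightarrow>
    (\<forall>i i'. (i, 0) \<in> skew_diagram \<alpha> \<mu> \<and> (i', 0) \<in> skew_diagram \<alpha> \<mu> \<and> i < i' \<longrightarrow> False)"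
    (is "?L \<longleftrightarrow> ?R")
  proof
    assume R: ?R
    show ?L
    proof (rule ccontr)
      assume "\<not> ?L"
      then show False
        using R[rule_format, of "len \<mu>" "Suc (len \<mu>)"] by (simp add: mem_skew_diagram_col0)
    qed
  qed (auto simp: mem_skew_diagram_col0)
  with False show ?thesis by (simp add: strip_def)
qed

text \<open>The value \<open>undefined\<close> outside both pieces keeps the result extensional, as
  \<open>fillings\<close> demands.\<close>

definition extend_filling ::
    "composition \<Rightarrow> composition \<Rightarrow> nat \<Rightarrow> composition \<Rightarrow> (nat \<times> nat \<Rightarrow> nat) \<Rightarrow> nat \<times> nat \<Rightarrow> nat" where
  "extend_filling \<beta> \<alpha> k \<mu> T c =
     (if c \<in> skew_diagram \<mu> \<beta> then T c else if c \<in> skew_diagram \<alpha> \<mu> then k else undefined)"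

lemma skew_diagram_split:
  assumes "contained \<beta> \<mu>" "contained \<mu> \<alpha>"
  shows "skew_diagram \<alpha> \<beta> = skew_diagram \<mu> \<beta> \<union> skew_diagram \<alpha> \<mu>"
    "skew_diagram \<mu> \<beta> \<inter> skew_diagram \<alpha> \<mu> = {}"
  using assms by (auto simp: contained_iff_diagram skew_diagram_def)

lemma content_split:
  assumes c: "contained \<beta> \<mu>" "contained \<mu> \<alpha>"
    and T: "\<And>c. c \<in> skew_diagram \<alpha> \<mu> \<Longrightarrow> T c = k"
    and T': "\<And>c. c \<in> skew_diagram \<mu> \<beta> \<Longrightarrow> T c = T' c"
  shows "content (skew_diagram \<alpha> \<beta>) T =
    content (skew_diagram \<mu> \<beta>) T' + Poly_Mapping.single k (weight \<alpha> - weight \<mu>)"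
proof -
  have "content (skew_diagram \<alpha> \<beta>) T =
      (\<Sum>c\<in>skew_diagram \<mu> \<beta>. Poly_Mapping.single (T c) 1)
      + (\<Sum>c\<in>skew_diagram \<alpha> \<mu>. Poly_Mapping.single (T c) 1)"
    unfolding content_def skew_diagram_split(1)[OF c]
    by (rule sum.union_disjoint) (simp_all add: finite_skew_diagram skew_diagram_split(2)[OF c])
  also have "(\<Sum>c\<in>skew_diagram \<mu> \<beta>. Poly_Mapping.single (T c) 1) = content (skew_diagram \<mu> \<beta>) T'"
    unfolding content_def using T' by (intro sum.cong) auto
  also have "(\<Sum>c\<in>skew_diagram \<alpha> \<mu>. Poly_Mapping.single (T c) 1) =
      (\<Sum>c\<in>skew_diagram \<alpha> \<mu>. Poly_Mapping.single k (1::nat))"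
    using T by (intro sum.cong) auto
  also have "\<dots> = Poly_Mapping.single k (weight \<alpha> - weight \<mu>)"
  proof -
    have "(\<Sum>c\<in>D. Poly_Mapping.single k (1::nat)) = Poly_Mapping.single k (card D)"
      for D :: "(nat \<times> nat) set"
      by (rule poly_mapping_eqI) (simp add: lookup_sum lookup_single when_def card_eq_sum del: sum_constant)
    then show ?thesis
      by (simp only: card_skew_diagram[OF c(2)])
  qed
  finally show ?thesis .
qed

text \<open>Since \<open>skew_diagram\<close> is a plain set difference, it is meaningful as a shape
  only under containment. The value 0 otherwise lets the recursion sum over all strips below
  \<alpha>, whether or not they contain \<beta>.\<close>

definition tableaux_count :: "bool \<Rightarrow> composition \<Rightarrow> composition \<Rightarrow> (nat \<Rightarrow>\<^sub>0 nat) \<Rightarrow> nat" where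
  "tableaux_count p \<beta> \<alpha> m = (if contained \<beta> \<alpha>
     then card {T \<in> tableaux p (skew_diagram \<alpha> \<beta>). content (skew_diagram \<alpha> \<beta>) T = m} else 0)"

lemma entry_in_keys:
  assumes "finite D" "c \<in> D"
  shows "T c \<in> Poly_Mapping.keys (content D T)"
proof -
  have "c \<in> {c' \<in> D. T c' = T c}" "finite {c' \<in> D. T c' = T c}"
    using assms by auto
  then have "card {c' \<in> D. T c' = T c} \<noteq> 0"
    by (metis card_0_eq empty_iff)
  then show ?thesis
    by (simp add: in_keys_iff lookup_content[OF assms(1)])
qed

text \<open>Within a row or the first column the new cells come after the old ones. A comparison of
  old with new is strict because old entries are below \<open>k\<close>; a comparison of new with
  new is an equality, permitted by the strip condition.\<close>

lemma tableaux_extend: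
  assumes T: "T \<in> tableaux p (skew_diagram \<mu> \<beta>)"
    and c: "contained \<beta> \<mu>" and s: "strip p \<mu> \<alpha>"
    and less: "\<And>c. c \<in> skew_diagram \<mu> \<beta> \<Longrightarrow> T c < k" and "0 < k"
  shows "extend_filling \<beta> \<alpha> k \<mu> T \<in> tableaux p (skew_diagram \<alpha> \<beta>)"
proof -
  let ?E = "extend_filling \<beta> \<alpha> k \<mu> T"
  note split = skew_diagram_split[OF c strip_contained[OF s]]
  have E1: "?E c = T c" if "c \<in> skew_diagram \<mu> \<beta>" for c
    using that by (simp add: extend_filling_def)
  have E2: "?E c = k" if "c \<in> skew_diagram \<alpha> \<mu>" for c
    using that split(2) by (auto simp: extend_filling_def)
  have fill: "?E \<in> fillings (skew_diagram \<alpha> \<beta>)"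
    using T \<open>0 < k\<close> unfolding tableaux_def fillings_def split
    by (fastforce simp: extend_filling_def PiE_iff extensional_def)
  have colT: "T (i, 0) < T (i', 0) \<or> p \<and> T (i, 0) = T (i', 0)"
    if "(i, 0) \<in> skew_diagram \<mu> \<beta>" "(i', 0) \<in> skew_diagram \<mu> \<beta>" "i < i'" for i i'
    using T that by (simp add: tableaux_def)
  have rowT: "T (i, j) < T (i, j') \<or> \<not> p \<and> T (i, j) = T (i, j')"
    if "(i, j) \<in> skew_diagram \<mu> \<beta>" "(i, j') \<in> skew_diagram \<mu> \<beta>" "j < j'" for i j j'
    using T that by (simp add: tableaux_def)
  have col: "?E (i, 0) < ?E (i', 0) \<or> p \<and> ?E (i, 0) = ?E (i', 0)"
    if "(i, 0) \<in> skew_diagram \<alpha> \<beta>" "(i', 0) \<in> skew_diagram \<alpha> \<beta>" "i < i'" for i i'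
  proof (cases "(i, 0) \<in> skew_diagram \<mu> \<beta>")
    case True
    then show ?thesis
      using colT[OF True _ that(3)] that(2) E1[OF True] E1[of "(i', 0)"] E2[of "(i', 0)"] less[OF True]
      unfolding split by auto
  next
    case False
    then have i: "(i, 0) \<in> skew_diagram \<alpha> \<mu>"
      using that split by blast
    then have i': "(i', 0) \<in> skew_diagram \<alpha> \<mu>"
      using that by (simp add: mem_skew_diagram_col0)
    then have p using s i that(3) unfolding strip_iff by blast
    then show ?thesis using E2[OF i] E2[OF i'] by simp
  qed
  have row: "?E (i, j) < ?E (i, j') \<or> \<not> p \<and> ?E (i, j) = ?E (i, j')"
    if "(i, j) \<in> skew_diagram \<alpha> \<beta>" "(i, j') \<in> skew_diagram \<alpha> \<beta>" "j < j'" for i j j'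
  proof (cases "(i, j) \<in> skew_diagram \<mu> \<beta>")
    case True
    then show ?thesis
      using rowT[OF True _ that(3)] that(2) E1[OF True] E1[of "(i, j')"] E2[of "(i, j')"] less[OF True]
      unfolding split by auto
  next
    case False
    then have i: "(i, j) \<in> skew_diagram \<alpha> \<mu>"
      using that split by blast
    then have i': "(i, j') \<in> skew_diagram \<alpha> \<mu>"
      using that by (simp add: mem_skew_diagram)
    then have "\<not> p" using s i that(3) unfolding strip_iff by blast
    then show ?thesis using E2[OF i] E2[OF i'] by simp
  qed
  show ?thesis
    using fill col row by (simp add: tableaux_def)
qed

text \<open>For either \<open>p\<close> the entries weakly increase along rows and up the first
  column, so \<beta> together with the cells of entry below \<open>k\<close> is again a diagram. The
  remaining cells all carry \<open>k\<close>, and the tableau conditions on them say that they form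
  a strip.\<close>

lemma tableaux_cut:
  assumes T: "T \<in> tableaux p (skew_diagram \<alpha> \<beta>)" and c: "contained \<beta> \<alpha>"
    and le: "\<And>c. c \<in> skew_diagram \<alpha> \<beta> \<Longrightarrow> T c \<le> k"
  obtains \<mu> where "contained \<beta> \<mu>" "strip p \<mu> \<alpha>"
    "\<And>c. c \<in> skew_diagram \<mu> \<beta> \<Longrightarrow> T c < k" "\<And>c. c \<in> skew_diagram \<alpha> \<mu> \<Longrightarrow> T c = k"
    "restrict T (skew_diagram \<mu> \<beta>) \<in> tableaux p (skew_diagram \<mu> \<beta>)"
proof -
  let ?A = "skew_diagram \<alpha> \<beta>"
  let ?D = "diagram \<beta> \<union> {c \<in> ?A. T c < k}"
  have col: "T (i, 0) < T (i', 0) \<or> p \<and> T (i, 0) = T (i', 0)"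
    if "(i, 0) \<in> ?A" "(i', 0) \<in> ?A" "i < i'" for i i'
    using T that by (simp add: tableaux_def)
  have row: "T (i, j) < T (i, j') \<or> \<not> p \<and> T (i, j) = T (i, j')"
    if "(i, j) \<in> ?A" "(i, j') \<in> ?A" "j < j'" for i j j'
    using T that by (simp add: tableaux_def)
  have "\<exists>\<mu>. diagram \<mu> = ?D"
  proof (rule ex_diagram)
    show "finite ?D"
      by (simp add: finite_diagram finite_skew_diagram)
    show "(i, j') \<in> ?D" if "(i, j) \<in> ?D" "j' \<le> j" for i j j'
    proof (cases "(i, j') \<in> diagram \<beta> \<or> j' = j")
      case False
      then have "(i, j) \<in> ?A" "(i, j') \<in> ?A" "j' < j" "T (i, j) < k"
        using that c by (auto simp: mem_diagram mem_skew_diagram)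
      then show ?thesis using row[of i j' j] by auto
    qed (use that in auto)
    show "(i', 0) \<in> ?D" if "(i, 0) \<in> ?D" "i' \<le> i" for i i'
    proof (cases "(i', 0) \<in> diagram \<beta> \<or> i' = i")
      case False
      then have "(i, 0) \<in> ?A" "(i', 0) \<in> ?A" "i' < i" "T (i, 0) < k"
        using that c by (auto simp: mem_diagram mem_skew_diagram_col0 rowlen_pos_iff)
      then show ?thesis using col[of i' i] by auto
    qed (use that in auto)
  qed
  then obtain \<mu> where \<mu>: "diagram \<mu> = ?D" by blast
  have sub: "skew_diagram \<mu> \<beta> = {c \<in> ?A. T c < k}"
    unfolding skew_diagram_def \<mu> by (auto simp: skew_diagram_def)
  have "skew_diagram \<alpha> \<mu> = {c \<in> ?A. \<not> T c < k}"
    unfolding skew_diagram_def \<mu> using c by (auto simp: skew_diagram_def contained_iff_diagram)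
  then have top: "skew_diagram \<alpha> \<mu> = {c \<in> ?A. T c = k}"
    using le by (auto simp: not_less intro: antisym)
  have "contained \<beta> \<mu>" "contained \<mu> \<alpha>"
    using \<mu> c by (auto simp: contained_iff_diagram skew_diagram_def)
  moreover have "strip p \<mu> \<alpha>"
    unfolding strip_iff top using \<open>contained \<mu> \<alpha>\<close> col row by fastforce
  moreover have "restrict T (skew_diagram \<mu> \<beta>) \<in> tableaux p (skew_diagram \<mu> \<beta>)"
    using T unfolding sub tableaux_def fillings_def by (auto simp: PiE_iff)
  ultimately show ?thesis
    using that[of \<mu>] sub top by blast
qed

lemma finite_tableaux_fibre:
  "finite {T \<in> tableaux p (skew_diagram \<alpha> \<beta>). content (skew_diagram \<alpha> \<beta>) T = m}"
  by (rule finite_content_fibre[OF finite_skew_diagram]) (auto simp: tableaux_def)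

lemma finite_weight_le: "finite {\<mu>. weight \<mu> \<le> n}"
proof -
  have "{\<mu>. weight \<mu> \<le> n} = (\<Union>k\<le>n. {\<mu>. weight \<mu> = k})" by auto
  then show ?thesis by (simp add: finite_compositions)
qed

lemma finite_strips: "finite {\<mu>. strip p \<mu> \<alpha> \<and> P \<mu>}"
  by (rule finite_subset[OF _ finite_weight_le[of "weight \<alpha>"]])
    (auto dest: strip_contained contained_weight)

text \<open>Cutting and gluing at the largest letter \<open>k\<close> are inverse bijections between
  tableaux of shape \<alpha>/\<beta> and pairs of a strip \<alpha>/\<mu> of size \<open>g\<close>
  and a tableau of shape \<mu>/\<beta> with content \<open>m\<close>.\<close>

lemma tableaux_count_snoc:
  assumes k: "\<forall>x\<in>Poly_Mapping.keys m. x < k" "0 < k" and g: "0 < g"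
  shows "tableaux_count p \<beta> \<alpha> (m + Poly_Mapping.single k g) =
    (\<Sum>\<mu> | strip p \<mu> \<alpha> \<and> weight \<mu> + g = weight \<alpha>. tableaux_count p \<beta> \<mu> m)"
proof (cases "contained \<beta> \<alpha>")
  case False
  have "tableaux_count p \<beta> \<mu> m = 0" if "strip p \<mu> \<alpha>" for \<mu>
    using that False by (auto simp: tableaux_count_def dest: strip_contained contained_trans)
  with False show ?thesis by (simp add: tableaux_count_def)
next
  case c: True
  let ?S = "{\<mu>. strip p \<mu> \<alpha> \<and> weight \<mu> + g = weight \<alpha>}"
  let ?S' = "{\<mu>\<in>?S. contained \<beta> \<mu>}"
  let ?X = "\<lambda>\<mu> m. {T \<in> tableaux p (skew_diagram \<mu> \<beta>). content (skew_diagram \<mu> \<beta>) T = m}"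
  let ?m = "m + Poly_Mapping.single k g"
  let ?f = "\<lambda>(\<mu>, T). extend_filling \<beta> \<alpha> k \<mu> T"
  have km: "Poly_Mapping.lookup m k = 0"
    using k(1) by (metis in_keys_iff less_irrefl)
  have small: "T c < k" if "T \<in> ?X \<mu> m" "c \<in> skew_diagram \<mu> \<beta>" for T \<mu> c
    using entry_in_keys[OF finite_skew_diagram that(2), of T] that k(1) by auto
  \<comment> \<open>The shape \<mu> can be read off the glued filling as the region of entries below
    \<open>k\<close>; injectivity rests on this.\<close>
  have eq: "c \<in> skew_diagram \<mu> \<beta> \<longleftrightarrow> c \<in> skew_diagram \<alpha> \<beta> \<and> extend_filling \<beta> \<alpha> k \<mu> T c < k"
    if "\<mu> \<in> ?S'" "T \<in> ?X \<mu> m" for \<mu> T c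
    using skew_diagram_split[of \<beta> \<mu> \<alpha>] that small[OF that(2), of c] strip_contained[of p \<mu> \<alpha>]
    by (auto simp: extend_filling_def)
  have "bij_betw ?f (SIGMA \<mu>:?S'. ?X \<mu> m) (?X \<alpha> ?m)"
    unfolding bij_betw_def
  proof
    show "inj_on ?f (SIGMA \<mu>:?S'. ?X \<mu> m)"
    proof (rule inj_onI)
      fix x y assume x: "x \<in> (SIGMA \<mu>:?S'. ?X \<mu> m)" and y: "y \<in> (SIGMA \<mu>:?S'. ?X \<mu> m)"
        and f: "?f x = ?f y"
      obtain \<mu> T where xe: "x = (\<mu>, T)" and \<mu>: "\<mu> \<in> ?S'" "T \<in> ?X \<mu> m" using x by auto
      obtain \<mu>' T' where ye: "y = (\<mu>', T')" and \<mu>': "\<mu>' \<in> ?S'" "T' \<in> ?X \<mu>' m" using y by auto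
      have e: "extend_filling \<beta> \<alpha> k \<mu> T = extend_filling \<beta> \<alpha> k \<mu>' T'" using f xe ye by simp
      have s: "skew_diagram \<mu> \<beta> = skew_diagram \<mu>' \<beta>"
        using eq[OF \<mu>] eq[OF \<mu>'] e by auto
      then have "diagram \<mu> = diagram \<mu>'"
        using \<mu> \<mu>' by (auto simp: skew_diagram_def contained_iff_diagram)
      moreover have "T c = T' c" for c
      proof (cases "c \<in> skew_diagram \<mu> \<beta>")
        case True
        then show ?thesis using fun_cong[OF e, of c] s by (simp add: extend_filling_def)
      next
        case False
        then have "T c = undefined" "T' c = undefined"
          using \<mu>(2) \<mu>'(2) s by (auto simp: tableaux_def fillings_def intro: PiE_arb)
        then show ?thesis by simp
      qed
      ultimately show "x = y"
        by (auto simp: diagram_inject xe ye)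
    qed
    show "?f ` (SIGMA \<mu>:?S'. ?X \<mu> m) = ?X \<alpha> ?m"
    proof (intro equalityI subsetI)
      fix T assume "T \<in> ?f ` (SIGMA \<mu>:?S'. ?X \<mu> m)"
      then obtain \<mu> T' where \<mu>: "\<mu> \<in> ?S'" "T' \<in> ?X \<mu> m" and T: "T = extend_filling \<beta> \<alpha> k \<mu> T'"
        by auto
      have "T \<in> tableaux p (skew_diagram \<alpha> \<beta>)"
        unfolding T using \<mu> small[OF \<mu>(2)] k(2) by (intro tableaux_extend) auto
      moreover have "content (skew_diagram \<alpha> \<beta>) T =
          content (skew_diagram \<mu> \<beta>) T' + Poly_Mapping.single k (weight \<alpha> - weight \<mu>)"
        unfolding T using \<mu> skew_diagram_split(2)[of \<beta> \<mu> \<alpha>] strip_contained[of p \<mu> \<alpha>]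
        by (intro content_split) (auto simp: extend_filling_def)
      moreover have "weight \<alpha> - weight \<mu> = g"
        using \<mu> by auto
      ultimately show "T \<in> ?X \<alpha> ?m"
        using \<mu> by auto
    next
      fix T assume T: "T \<in> ?X \<alpha> ?m"
      have "T c \<le> k" if "c \<in> skew_diagram \<alpha> \<beta>" for c
      proof -
        have "T c \<in> Poly_Mapping.keys ?m"
          using entry_in_keys[OF finite_skew_diagram that, of T] T by simp
        then have "T c \<in> Poly_Mapping.keys m \<or> T c = k"
          using keys_add[of m "Poly_Mapping.single k g"] g by auto
        then show ?thesis using k(1) by auto
      qed
      moreover have "T \<in> tableaux p (skew_diagram \<alpha> \<beta>)" using T by simp
      ultimately obtain \<mu> where \<mu>: "contained \<beta> \<mu>" "strip p \<mu> \<alpha>"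
        "\<And>c. c \<in> skew_diagram \<mu> \<beta> \<Longrightarrow> T c < k" "\<And>c. c \<in> skew_diagram \<alpha> \<mu> \<Longrightarrow> T c = k"
        "restrict T (skew_diagram \<mu> \<beta>) \<in> tableaux p (skew_diagram \<mu> \<beta>)"
        using tableaux_cut[OF _ c] by metis
      let ?T = "restrict T (skew_diagram \<mu> \<beta>)"
      have ct: "?m = content (skew_diagram \<mu> \<beta>) ?T + Poly_Mapping.single k (weight \<alpha> - weight \<mu>)"
        using content_split[OF \<mu>(1) strip_contained[OF \<mu>(2)], of T k ?T] \<mu>(4) T by simp
      \<comment> \<open>As \<open>k\<close> occurs neither below the cut nor in \<open>m\<close>,
        comparing exponents at \<open>k\<close> gives the size of the strip.\<close>
      have "{c \<in> skew_diagram \<mu> \<beta>. ?T c = k} = {}"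
        using \<mu>(3) by fastforce
      then have "Poly_Mapping.lookup (content (skew_diagram \<mu> \<beta>) ?T) k = 0"
        unfolding lookup_content[OF finite_skew_diagram] by (metis card.empty)
      then have g': "g = weight \<alpha> - weight \<mu>"
        using arg_cong[OF ct, of "\<lambda>m. Poly_Mapping.lookup m k"] km by (simp add: lookup_add)
      then have "content (skew_diagram \<mu> \<beta>) ?T = m"
        using ct by simp
      \<comment> \<open>Positivity of \<open>g\<close> ensures that the truncated subtraction in
        \<open>g'\<close> is exact.\<close>
      moreover have "weight \<mu> + g = weight \<alpha>"
        using g' g by simp
      ultimately have mem: "(\<mu>, ?T) \<in> (SIGMA \<mu>:?S'. ?X \<mu> m)"
        using \<mu> by auto
      have "?f (\<mu>, ?T) = T"
      proof
        fix c
        have "T c = undefined" if "c \<notin> skew_diagram \<alpha> \<beta>"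
          using T that by (auto simp: tableaux_def fillings_def intro: PiE_arb)
        moreover have "c \<in> skew_diagram \<alpha> \<beta> \<longleftrightarrow> c \<in> skew_diagram \<mu> \<beta> \<or> c \<in> skew_diagram \<alpha> \<mu>"
          using skew_diagram_split(1)[OF \<mu>(1) strip_contained[OF \<mu>(2)]] by blast
        ultimately show "?f (\<mu>, ?T) c = T c"
          using \<mu>(4)[of c] unfolding extend_filling_def by simp
      qed
      then show "T \<in> ?f ` (SIGMA \<mu>:?S'. ?X \<mu> m)"
        using imageI[OF mem, of ?f] by (simp only:)
    qed
  qed
  then have "card (?X \<alpha> ?m) = card (SIGMA \<mu>:?S'. ?X \<mu> m)"
    by (simp add: bij_betw_same_card)
  also have "\<dots> = (\<Sum>\<mu>\<in>?S'. card (?X \<mu> m))"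
  proof (rule card_SigmaI)
    show "finite ?S'"
      by (rule finite_subset[OF _ finite_strips[of p \<alpha> "\<lambda>_. True"]]) auto
  qed (simp add: finite_tableaux_fibre)
  also have "\<dots> = (\<Sum>\<mu>\<in>?S'. tableaux_count p \<beta> \<mu> m)"
    by (intro sum.cong) (simp_all add: tableaux_count_def)
  also have "\<dots> = (\<Sum>\<mu>\<in>?S. tableaux_count p \<beta> \<mu> m)"
    by (intro sum.mono_neutral_left finite_strips) (auto simp: tableaux_count_def)
  finally show ?thesis
    using c by (simp add: tableaux_count_def)
qed


section \<open>Adding strips\<close>

definition grow :: "bool \<Rightarrow> nat \<Rightarrow> (composition \<Rightarrow> 'a::comm_ring_1) \<Rightarrow> composition \<Rightarrow> 'a" where
  "grow p n v \<alpha> = (\<Sum>\<mu> | strip p \<mu> \<alpha> \<and> weight \<mu> + n = weight \<alpha>. v \<mu>)"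

definition point :: "composition \<Rightarrow> composition \<Rightarrow> 'a::comm_ring_1" where
  "point \<beta> \<alpha> = (if \<alpha> = \<beta> then 1 else 0)"

lemma grow_sum:
  "grow p n (\<lambda>\<alpha>. \<Sum>i\<in>I. a i * v i \<alpha>) \<alpha> = (\<Sum>i\<in>I. a i * grow p n (v i) \<alpha>)"
  unfolding grow_def sum_distrib_left by (rule sum.swap)

lemma fold_grow_sum:
  "fold (grow p) ns (\<lambda>\<alpha>. \<Sum>i\<in>I. a i * v i \<alpha>) = (\<lambda>\<alpha>. \<Sum>i\<in>I. a i * fold (grow p) ns (v i) \<alpha>)"
proof (induction ns rule: rev_induct)
  case (snoc n ns)
  then show ?case by (simp add: grow_sum)
qed simp

text \<open>Each \<open>grow p n\<close> shifts the weight of the support by exactly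
  \<open>n\<close>.\<close>

lemma fold_grow_weight:
  assumes "weight \<alpha> \<noteq> weight \<beta> + sum_list ns"
  shows "fold (grow p) ns (point \<beta>) \<alpha> = (0::'a::comm_ring_1)"
  using assms
proof (induction ns arbitrary: \<alpha> rule: rev_induct)
  case Nil
  then show ?case by (auto simp: point_def)
next
  case (snoc n ns)
  have "fold (grow p) ns (point \<beta>) \<mu> = (0::'a)" if "weight \<mu> + n = weight \<alpha>" for \<mu>
    using that snoc.prems by (intro snoc.IH) simp
  then show ?case
    by (simp add: grow_def[of p n] sum.neutral)
qed

section \<open>Tableau counts as chains of strips\<close>

lemma index_seqs_snocE:
  assumes "is \<in> index_seqs (Suc n)"
  obtains js k where "is = js @ [k]" "js \<in> index_seqs n" "\<forall>x\<in>set js. x < k" "0 < k"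
proof (cases "is" rule: rev_cases)
  case Nil
  then show ?thesis using assms by (simp add: index_seqs_def)
next
  case (snoc js k)
  then show ?thesis
    using assms that[of js k] by (auto simp: index_seqs_def sorted_wrt_append)
qed

lemma placed_snoc:
  assumes "length js = len \<gamma>" "0 < n"
  shows "placed (js @ [k]) (\<gamma> + single_row n) = placed js \<gamma> + Poly_Mapping.single k n"
proof -
  have "(\<Sum>j<len \<gamma>. Poly_Mapping.single ((js @ [k]) ! j) (part (\<gamma> + single_row n) j)) = placed js \<gamma>"
    unfolding placed_def using assms
    by (intro sum.cong) (auto simp: nth_append part_def len_def)
  moreover have "part (\<gamma> + single_row n) (len \<gamma>) = n"
    using assms(2) by (simp add: part_def len_def)
  ultimately show ?thesis
    using assms by (simp add: placed_def nth_append)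
qed

lemma tableaux_count_zero: "tableaux_count p \<beta> \<alpha> 0 = (if \<alpha> = \<beta> then 1 else 0)"
proof (cases "\<alpha> = \<beta>")
  case True
  have "{T \<in> tableaux p {}. content {} T = 0} = {\<lambda>_. undefined}"
    by (auto simp: tableaux_def fillings_def content_def)
  then show ?thesis using True by (simp add: tableaux_count_def skew_diagram_def)
next
  case False
  have "content (skew_diagram \<alpha> \<beta>) T \<noteq> 0" if c: "contained \<beta> \<alpha>" for T
  proof -
    have "diagram \<beta> \<noteq> diagram \<alpha>" using False by (simp add: diagram_inject)
    then obtain c where "c \<in> skew_diagram \<alpha> \<beta>"
      using c unfolding contained_iff_diagram skew_diagram_def by blast
    then show ?thesis
      using entry_in_keys[OF finite_skew_diagram, of c \<alpha> \<beta> T] by auto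
  qed
  then show ?thesis using False by (simp add: tableaux_count_def)
qed

text \<open>The last index is the largest letter, so \<open>tableaux_count_snoc\<close> removes it
  together with the last part. The right-hand side does not mention \<open>is\<close>: this is the
  quasisymmetry of the tableau series.\<close>

lemma tableaux_count_placed:
  assumes "is \<in> index_seqs (len \<gamma>)"
  shows "of_nat (tableaux_count p \<beta> \<alpha> (placed is \<gamma>)) = fold (grow p) (parts \<gamma>) (point \<beta>) \<alpha>"
  using assms
proof (induction \<gamma> arbitrary: "is" \<alpha> rule: composition_snoc_induct)
  case zero
  have "placed is 0 = 0" by (simp add: placed_def)
  then show ?case by (simp add: tableaux_count_zero point_def)
next
  case (snoc \<gamma> n)
  then have "is \<in> index_seqs (Suc (len \<gamma>))" by simp
  then obtain js k where js: "is = js @ [k]" "js \<in> index_seqs (len \<gamma>)" "\<forall>x\<in>set js. x < k" "0 < k"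
    by (rule index_seqs_snocE)
  have len: "length js = len \<gamma>"
    using js(2) by (simp add: index_seqs_def)
  have "tableaux_count p \<beta> \<alpha> (placed is (\<gamma> + single_row n)) =
      (\<Sum>\<mu> | strip p \<mu> \<alpha> \<and> weight \<mu> + n = weight \<alpha>. tableaux_count p \<beta> \<mu> (placed js \<gamma>))"
    unfolding js(1) placed_snoc[OF len snoc(1)]
    by (rule tableaux_count_snoc) (use js keys_placed[OF js(2)] snoc(1) in auto)
  then show ?case
    using snoc(1) snoc.IH[OF js(2)] by (simp add: grow_def)
qed


section \<open>Pairing with tableau series\<close>

lemma monomial_qsym_placed:
  assumes "is \<in> index_seqs (len \<alpha>)"
  shows "monomial_qsym \<beta> (placed is \<alpha>) = (if \<alpha> = \<beta> then 1 else 0)"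
proof -
  have "{js \<in> index_seqs (len \<beta>). placed js \<beta> = placed is \<alpha>} = (if \<alpha> = \<beta> then {is} else {})"
    using placed_inj[OF _ assms] assms by auto
  then show ?thesis by (simp add: monomial_qsym_def)
qed

lemma monomial_combination_placed:
  assumes "is \<in> index_seqs (len \<alpha>)"
  shows "monomial_combination c (placed is \<alpha>) = Poly_Mapping.lookup c \<alpha>"
  by (simp add: monomial_combination_def monomial_qsym_placed[OF assms] in_keys_iff if_distrib
      cong: if_cong)

text \<open>Equality of series concerns all exponent vectors, also those involving index 0, which
  belongs to no variable. Here and in \<open>tableau_series_0_in_keys\<close> both sides vanish; the
  other monomials are covered by \<open>ex_placed\<close>.\<close>

lemma monomial_qsym_0_in_keys:
  assumes "0 \<in> Poly_Mapping.keys m"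
  shows "monomial_qsym \<beta> m = 0"
proof -
  have "placed js \<beta> \<noteq> m" if "js \<in> index_seqs (len \<beta>)" for js
    using keys_placed[OF that] that assms by (auto simp: index_seqs_def)
  then have "{js \<in> index_seqs (len \<beta>). placed js \<beta> = m} = {}" by blast
  then show ?thesis by (simp only: monomial_qsym_def card.empty of_nat_0)
qed

lemma tableau_series_0_in_keys:
  assumes "0 \<in> Poly_Mapping.keys m" "finite D"
  shows "tableau_series D (tableaux p D) m = 0"
proof -
  have "content D T \<noteq> m" if "T \<in> tableaux p D" for T
  proof
    assume "content D T = m"
    then have "Poly_Mapping.lookup (content D T) 0 \<noteq> 0"
      using assms(1) by (simp only: in_keys_iff not_False_eq_True)
    then have "{c \<in> D. T c = 0} \<noteq> {}"
      unfolding lookup_content[OF assms(2)] by (intro notI) (simp only: card.empty)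
    then obtain c where "c \<in> D" "T c = 0"
      by blast
    then show False
      using that by (auto simp: tableaux_def fillings_def PiE_iff)
  qed
  then have "{T \<in> tableaux p D. content D T = m} = {}" by blast
  then show ?thesis by (simp only: tableau_series_def card.empty of_nat_0)
qed

text \<open>Sort the support of the monomial and list its exponents in that order.\<close>

lemma ex_placed:
  assumes "0 \<notin> Poly_Mapping.keys m"
  shows "\<exists>is \<alpha>. is \<in> index_seqs (len \<alpha>) \<and> placed is \<alpha> = m"
proof -
  define js where "js = sorted_list_of_set (Poly_Mapping.keys m)"
  define \<alpha> where "\<alpha> = Composition (map (Poly_Mapping.lookup m) js)"
  have set: "set js = Poly_Mapping.keys m"
    by (simp add: js_def)
  have parts: "parts \<alpha> = map (Poly_Mapping.lookup m) js"
    unfolding \<alpha>_def using set by (intro Composition_inverse) (auto simp: in_keys_iff)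
  then have part: "part \<alpha> j = Poly_Mapping.lookup m (js ! j)" if "j < length js" for j
    using that by (simp add: part_def)
  have len: "len \<alpha> = length js"
    using parts by (simp add: len_def)
  have ix: "js \<in> index_seqs (len \<alpha>)"
    using assms set len by (simp add: index_seqs_def js_def strict_sorted_list_of_set)
  have "Poly_Mapping.lookup (placed js \<alpha>) x = Poly_Mapping.lookup m x" for x
  proof (cases "x \<in> set js")
    case True
    then obtain j where "j < length js" "x = js ! j"
      by (auto simp: in_set_conv_nth)
    then show ?thesis using lookup_placed[OF ix] len part by simp
  next
    case False
    then show ?thesis using keys_placed[OF ix] set by (metis in_keys_iff)
  qed
  then have "placed js \<alpha> = m" by (rule poly_mapping_eqI)
  with ix show ?thesis by blast
qed

section \<open>Straight shapes and the monomial basis\<close>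

definition straight_series :: "bool \<Rightarrow> composition \<Rightarrow> 'a::comm_ring_1 series" where
  "straight_series p \<alpha> = tableau_series (diagram \<alpha>) (tableaux p (diagram \<alpha>))"

text \<open>The analogue of a Kostka number: the number of tableaux of shape \<alpha> and content
  \<gamma>, as an element of the ring.\<close>

abbreviation kostka :: "bool \<Rightarrow> composition \<Rightarrow> composition \<Rightarrow> 'a::comm_ring_1" where
  "kostka p \<gamma> \<alpha> \<equiv> fold (grow p) (parts \<gamma>) (point 0) \<alpha>"

lemma kostka_weight: "weight \<gamma> \<noteq> weight \<alpha> \<Longrightarrow> kostka p \<gamma> \<alpha> = (0::'a::comm_ring_1)"
  by (rule fold_grow_weight) (simp add: weight_def)

lemma skew_series_placed:
  assumes "contained \<beta> \<alpha>" "is \<in> index_seqs (len \<gamma>)"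
  shows "tableau_series (skew_diagram \<alpha> \<beta>) (tableaux p (skew_diagram \<alpha> \<beta>)) (placed is \<gamma>) =
    (fold (grow p) (parts \<gamma>) (point \<beta>) \<alpha> :: 'a::comm_ring_1)"
  using tableaux_count_placed[OF assms(2), of p \<beta> \<alpha>, symmetric, where 'a = 'a] assms(1)
  by (simp add: tableau_series_def tableaux_count_def)

lemma straight_series_placed:
  assumes "is \<in> index_seqs (len \<gamma>)"
  shows "straight_series p \<alpha> (placed is \<gamma>) = (kostka p \<gamma> \<alpha> :: 'a::comm_ring_1)"
proof -
  have "skew_diagram \<alpha> 0 = diagram \<alpha>"
    by (auto simp: skew_diagram_def diagram_def)
  then show ?thesis
    using skew_series_placed[OF _ assms, of 0 \<alpha> p, where 'a = 'a] by (simp add: straight_series_def)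
qed

lemma lookup_monomial_coeffs:
  "Poly_Mapping.lookup (monomial_coeffs (straight_series p \<alpha>)) \<gamma> = (kostka p \<gamma> \<alpha> :: 'a::comm_ring_1)"
proof -
  \<comment> \<open>Restricting to the weight of \<alpha> makes the support finite and by
    \<open>kostka_weight\<close> loses nothing.\<close>
  define c :: "composition \<Rightarrow>\<^sub>0 'a" where
    "c = (\<Sum>\<gamma> | weight \<gamma> = weight \<alpha>. Poly_Mapping.single \<gamma> (kostka p \<gamma> \<alpha>))"
  have c: "Poly_Mapping.lookup c \<gamma> = kostka p \<gamma> \<alpha>" for \<gamma>
    using kostka_weight[of \<gamma> \<alpha> p, where 'a = 'a]
    by (simp add: c_def lookup_sum lookup_single when_def finite_compositions)
  have "monomial_combination c m = straight_series p \<alpha> m" for m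
  proof (cases "0 \<in> Poly_Mapping.keys m")
    case True
    then show ?thesis
      by (simp add: monomial_combination_def monomial_qsym_0_in_keys straight_series_def
          tableau_series_0_in_keys finite_diagram)
  next
    case False
    then show ?thesis
      using ex_placed[OF False] by (auto simp: monomial_combination_placed straight_series_placed c)
  qed
  then have "monomial_combination c = straight_series p \<alpha>" by (rule ext)
  then have "monomial_coeffs (straight_series p \<alpha>) = c"
    unfolding monomial_coeffs_def using inv_f_f[OF inj_monomial_combination] by metis
  then show ?thesis by (simp add: c)
qed

text \<open>By homogeneity the sum may run over a fixed weight instead of the keys of
  \<open>f\<close>, which makes linearity in \<open>f\<close> visible.\<close>

lemma pairing_straight_series:
  fixes f :: "'a::comm_ring_1 nsym"
  shows "pairing f (straight_series p \<alpha>) =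
    (\<Sum>\<gamma> | weight \<gamma> = weight \<alpha>. Poly_Mapping.lookup f \<gamma> * kostka p \<gamma> \<alpha>)"
proof -
  let ?W = "{\<gamma>. weight \<gamma> = weight \<alpha>}"
  have "pairing f (straight_series p \<alpha>) = (\<Sum>\<gamma>\<in>Poly_Mapping.keys f. Poly_Mapping.lookup f \<gamma> * kostka p \<gamma> \<alpha>)"
    by (simp add: pairing_def lookup_monomial_coeffs)
  also have "\<dots> = (\<Sum>\<gamma>\<in>Poly_Mapping.keys f \<inter> ?W. Poly_Mapping.lookup f \<gamma> * kostka p \<gamma> \<alpha>)"
    using kostka_weight[of _ \<alpha> p, where 'a = 'a] by (intro sum.mono_neutral_right) auto
  also have "\<dots> = (\<Sum>\<gamma>\<in>?W. Poly_Mapping.lookup f \<gamma> * kostka p \<gamma> \<alpha>)"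
    by (intro sum.mono_neutral_left finite_compositions) (auto simp: in_keys_iff)
  finally show ?thesis .
qed

text \<open>Multiplication concatenates compositions, and \<open>fold\<close> over \<delta> +
  \<gamma> first runs through \<delta> and then through \<gamma>. Hence right multiplication applies
  the operators for \<gamma> afterwards, and linearity extends this from single \<delta> to
  \<open>f\<close>.\<close>

lemma pairing_mult_complete:
  fixes f :: "'a::comm_ring_1 nsym"
  shows "(\<lambda>\<alpha>. pairing (f * complete \<gamma>) (straight_series p \<alpha>)) =
    fold (grow p) (parts \<gamma>) (\<lambda>\<alpha>. pairing f (straight_series p \<alpha>))"
proof -
  let ?K = "Poly_Mapping.keys f" and ?f = "Poly_Mapping.lookup f"
  have f: "f = (\<Sum>\<delta>\<in>?K. Poly_Mapping.single \<delta> (?f \<delta>))"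
    by (rule poly_mapping_eqI) (simp add: lookup_sum lookup_single when_def in_keys_iff)
  then have "f * complete \<gamma> = (\<Sum>\<delta>\<in>?K. Poly_Mapping.single (\<delta> + \<gamma>) (?f \<delta>))"
    by (metis (no_types, lifting) sum_distrib_right complete_def mult_single mult.right_neutral
        sum.cong)
  then have l: "Poly_Mapping.lookup (f * complete \<gamma>) \<epsilon> = (\<Sum>\<delta>\<in>?K. ?f \<delta> * (if \<delta> + \<gamma> = \<epsilon> then 1 else 0))"
    for \<epsilon>
    by (simp add: lookup_sum lookup_single when_def if_distrib cong: if_cong)
  have "pairing (f * complete \<gamma>) (straight_series p \<alpha>) = (\<Sum>\<delta>\<in>?K. ?f \<delta> * kostka p (\<delta> + \<gamma>) \<alpha>)" for \<alpha>
  proof -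
    have "pairing (f * complete \<gamma>) (straight_series p \<alpha>) =
        (\<Sum>\<delta>\<in>?K. \<Sum>\<epsilon> | weight \<epsilon> = weight \<alpha>.
          ?f \<delta> * (if \<delta> + \<gamma> = \<epsilon> then 1 else 0) * kostka p \<epsilon> \<alpha>)"
      unfolding pairing_straight_series l sum_distrib_right by (rule sum.swap)
    also have "\<dots> = (\<Sum>\<delta>\<in>?K. ?f \<delta> * kostka p (\<delta> + \<gamma>) \<alpha>)"
    proof (rule sum.cong)
      fix \<delta>
      have "(\<Sum>\<epsilon> | weight \<epsilon> = weight \<alpha>. ?f \<delta> * (if \<delta> + \<gamma> = \<epsilon> then 1 else 0) * kostka p \<epsilon> \<alpha>) =
          (\<Sum>\<epsilon> | weight \<epsilon> = weight \<alpha>. if \<delta> + \<gamma> = \<epsilon> then ?f \<delta> * kostka p \<epsilon> \<alpha> else 0)"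
        by (rule sum.cong) auto
      also have "\<dots> = ?f \<delta> * kostka p (\<delta> + \<gamma>) \<alpha>"
        using kostka_weight[of "\<delta> + \<gamma>" \<alpha> p, where 'a = 'a] by (simp add: finite_compositions del: fold_append parts_plus)
      finally show "(\<Sum>\<epsilon> | weight \<epsilon> = weight \<alpha>. ?f \<delta> * (if \<delta> + \<gamma> = \<epsilon> then 1 else 0) * kostka p \<epsilon> \<alpha>)
        = ?f \<delta> * kostka p (\<delta> + \<gamma>) \<alpha>" .
    qed simp
    finally show ?thesis .
  qed
  moreover have "(\<lambda>\<alpha>. pairing f (straight_series p \<alpha>)) = (\<lambda>\<alpha>. \<Sum>\<delta>\<in>?K. ?f \<delta> * kostka p \<delta> \<alpha>)"
    by (simp add: pairing_def lookup_monomial_coeffs)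
  ultimately show ?thesis
    by (simp add: fold_grow_sum fun_eq_iff)
qed


section \<open>The relation between the two kinds of strips\<close>

text \<open>Sign-reversing involution: at the last row \<open>r\<close> in which \<open>\<alpha>\<close> and \<open>\<beta>\<close> differ, the two values
  \<open>\<beta>\<^sub>r\<close> and \<open>\<beta>\<^sub>r + 1\<close> of \<open>\<mu>\<^sub>r\<close> can be exchanged.\<close>

lemma signed_strip_sum:
  assumes "\<alpha> \<noteq> \<beta>"
  shows "(\<Sum>\<mu> | strip True \<beta> \<mu> \<and> strip False \<mu> \<alpha>. (-1::int) ^ weight \<mu>) = 0"
proof (cases "contained \<beta> \<alpha>")
  case False
  then have "{\<mu>. strip True \<beta> \<mu> \<and> strip False \<mu> \<alpha>} = {}"
    using contained_trans strip_contained by blast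
  then show ?thesis by (simp only: sum.empty)
next
  case c: True
  let ?M = "{\<mu>. strip True \<beta> \<mu> \<and> strip False \<mu> \<alpha>}"
  let ?I = "{i. rowlen \<beta> i < rowlen \<alpha> i}"
  define r where "r = Max ?I"
  have "?I \<subseteq> {..<len \<alpha>}"
    using rowlen_pos_iff[of \<alpha>] by (auto intro: gr_implies_not0 simp flip: rowlen_pos_iff)
  then have "finite ?I" by (rule finite_subset) simp
  moreover have "?I \<noteq> {}"
    using assms c rowlen_eqI by (metis (mono_tags, lifting) contained_iff empty_Collect_eq le_neq_implies_less)
  ultimately have r: "rowlen \<beta> r < rowlen \<alpha> r" and r_max: "\<And>i. rowlen \<beta> i < rowlen \<alpha> i \<Longrightarrow> i \<le> r"
    using Max_in[of ?I] Max_ge[of ?I] by (auto simp: r_def)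
  have r_eq: "rowlen \<alpha> i = rowlen \<beta> i" if "r < i" for i
    using c r_max[of i] that unfolding contained_iff by (metis le_neq_implies_less not_le)
  have rlen: "r < len \<alpha>"
    using r rowlen_pos_iff[of \<alpha> r] by linarith
  \<comment> \<open>Above row \<open>r\<close> the rows of \<alpha> and \<beta> agree. If row
    \<open>r\<close> is not in \<beta>, those rows are empty and \<open>r\<close> is the top row of
    \<alpha>.\<close>
  have top: "len \<alpha> = Suc r" if "\<not> r < len \<beta>"
  proof (rule ccontr)
    assume "len \<alpha> \<noteq> Suc r"
    then have "Suc r < len \<alpha>" using rlen by simp
    then have "0 < rowlen \<alpha> (Suc r)" by (simp add: rowlen_pos_iff)
    then have "Suc r < len \<beta>" using r_eq[of "Suc r"] rowlen_pos_iff by simp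
    then show False using that by simp
  qed
  have M: "\<mu> \<in> ?M \<longleftrightarrow> (\<forall>i. rowlen \<beta> i \<le> rowlen \<mu> i \<and> rowlen \<mu> i \<le> Suc (rowlen \<beta> i) \<and>
      rowlen \<mu> i \<le> rowlen \<alpha> i) \<and> len \<alpha> \<le> Suc (len \<mu>)" for \<mu>
    by (auto simp: strip_def contained_iff)
  \<comment> \<open>Reflection in \<open>2 * rowlen \<beta> r + 1\<close> swaps the two admissible
    lengths of row \<open>r\<close>; it remains to see that the result is a composition in
    \<open>?M\<close>.\<close>
  have step: "\<exists>\<mu>'. rowlen \<mu>' = (rowlen \<mu>)(r := 2 * rowlen \<beta> r + 1 - rowlen \<mu> r) \<and> \<mu>' \<in> ?M" if "\<mu> \<in> ?M" for \<mu>
  proof -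
    let ?f = "(rowlen \<mu>)(r := 2 * rowlen \<beta> r + 1 - rowlen \<mu> r)"
    have \<mu>: "rowlen \<beta> i \<le> rowlen \<mu> i" "rowlen \<mu> i \<le> Suc (rowlen \<beta> i)" "rowlen \<mu> i \<le> rowlen \<alpha> i"
      "len \<alpha> \<le> Suc (len \<mu>)" for i
      using that M by blast+
    have lm: "len \<mu> \<le> len \<alpha>"
      using \<mu>(3) contained_iff contained_len by blast
    \<comment> \<open>The number of rows changes only if row \<open>r\<close> lies outside \<beta>.
      It is then the top row of \<alpha>, so adding or removing it leaves no gap and costs at most
      the one row that an ordinary strip may add.\<close>
    define n where "n = (if r < len \<beta> then len \<mu> else if 0 < ?f r then Suc r else r)"
    have n: "0 < ?f i \<longleftrightarrow> i < n" for i
    proof (cases "r < len \<beta>")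
      case True
      then have "0 < rowlen \<beta> r" by (simp add: rowlen_pos_iff)
      then have "0 < ?f r" "0 < rowlen \<mu> r"
        using \<mu>(1)[of r] \<mu>(2)[of r] by auto
      then show ?thesis using True rowlen_pos_iff[of \<mu>] by (auto simp: n_def)
    next
      case False
      then show ?thesis
        using top[OF False] \<mu>(4) lm rowlen_pos_iff[of \<mu> i] by (auto simp: n_def)
    qed
    then obtain \<mu>' where \<mu>': "rowlen \<mu>' = ?f"
      using ex_composition_rowlen[of ?f] by blast
    have "i < len \<mu>' \<longleftrightarrow> i < n" for i
      using n[of i] rowlen_pos_iff[of \<mu>' i] by (simp add: \<mu>')
    then have "len \<mu>' = n"
      by (metis linorder_neqE_nat less_irrefl)
    then have "len \<alpha> \<le> Suc (len \<mu>')"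
      using \<mu>(4) top by (auto simp: n_def)
    moreover have "rowlen \<beta> r \<le> ?f r \<and> ?f r \<le> Suc (rowlen \<beta> r) \<and> ?f r \<le> rowlen \<alpha> r"
      unfolding fun_upd_same using \<mu>(1)[of r] \<mu>(2)[of r] r by arith
    ultimately have "\<mu>' \<in> ?M"
      unfolding M \<mu>' using \<mu>(1-3) by simp
    with \<mu>' show ?thesis by blast
  qed
  have "\<exists>t. \<forall>\<mu>\<in>?M. rowlen (t \<mu>) = (rowlen \<mu>)(r := 2 * rowlen \<beta> r + 1 - rowlen \<mu> r) \<and> t \<mu> \<in> ?M"
    by (rule bchoice, rule ballI, rule step)
  then obtain t where t: "\<And>\<mu>. \<mu> \<in> ?M \<Longrightarrow> t \<mu> \<in> ?M"
    "\<And>\<mu>. \<mu> \<in> ?M \<Longrightarrow> rowlen (t \<mu>) = (rowlen \<mu>)(r := 2 * rowlen \<beta> r + 1 - rowlen \<mu> r)"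
    by blast
  have bound: "rowlen \<beta> r \<le> rowlen \<mu> r \<and> rowlen \<mu> r \<le> Suc (rowlen \<beta> r)" if "\<mu> \<in> ?M" for \<mu>
    using that M by blast
  have tt: "t (t \<mu>) = \<mu>" if "\<mu> \<in> ?M" for \<mu>
  proof (rule rowlen_eqI)
    fix i
    show "rowlen (t (t \<mu>)) i = rowlen \<mu> i"
      unfolding t(2)[OF t(1)[OF that]] t(2)[OF that] using bound[OF that] by simp
  qed
  have sgn: "(-1::int) ^ weight (t \<mu>) = - ((-1) ^ weight \<mu>)" if "\<mu> \<in> ?M" for \<mu>
  proof -
    have w: "weight \<nu> = rowlen \<nu> r + (\<Sum>i\<in>{..<len \<alpha>} - {r}. rowlen \<nu> i)" if "\<nu> \<in> ?M" for \<nu>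
    proof -
      have "len \<nu> \<le> len \<alpha>" using that strip_contained contained_len by blast
      then show ?thesis
        unfolding weight_rowlen'[OF \<open>len \<nu> \<le> len \<alpha>\<close>] using rlen by (intro sum.remove) auto
    qed
    have "(\<Sum>i\<in>{..<len \<alpha>} - {r}. rowlen (t \<mu>) i) = (\<Sum>i\<in>{..<len \<alpha>} - {r}. rowlen \<mu> i)"
      unfolding t(2)[OF that] by (rule sum.cong) simp_all
    then have eq: "weight (t \<mu>) + rowlen \<mu> r = weight \<mu> + rowlen (t \<mu>) r"
      using w[OF that] w[OF t(1)[OF that]] by simp
    have "weight (t \<mu>) = Suc (weight \<mu>) \<or> weight \<mu> = Suc (weight (t \<mu>))"
    proof -
      have "rowlen \<mu> r = rowlen \<beta> r \<or> rowlen \<mu> r = Suc (rowlen \<beta> r)"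
        using bound[OF that] by auto
      then show ?thesis using eq unfolding t(2)[OF that] by auto
    qed
    then show ?thesis by auto
  qed
  \<comment> \<open>The sum equals its own negative, which forces 0 over the integers;
    \<open>grow_relation\<close> carries this to other rings through \<open>of_int\<close>, where 2
    may be a zero divisor.\<close>
  have "(\<Sum>\<mu>\<in>?M. (-1::int) ^ weight \<mu>) = (\<Sum>\<mu>\<in>?M. - ((-1) ^ weight \<mu>))"
    by (rule sum.reindex_bij_witness[of _ t t]) (simp_all only: t(1) tt sgn)
  then show ?thesis by (simp add: sum_negf)
qed

text \<open>For fixed \<beta> the coefficient of \<open>v \<beta>\<close> is, up to sign, the sum in
  \<open>signed_strip_sum\<close>, and \<beta> differs from \<alpha> because \<open>n\<close> is
  positive.\<close>

lemma grow_relation: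
  assumes "0 < n"
  shows "(\<Sum>k\<le>n. (-1) ^ k * grow False (n - k) (grow True k v) \<alpha>) = (0::'a::comm_ring_1)"
proof -
  let ?W = "{\<mu>. weight \<mu> \<le> weight \<alpha>}"
  let ?s = "\<lambda>\<beta> \<mu>. strip True \<beta> \<mu> \<and> strip False \<mu> \<alpha>"
  have fin: "finite ?W" by (rule finite_weight_le)
  \<comment> \<open>All sums are brought to one index set, so that they can be interchanged.\<close>
  have grow_W: "grow p k u \<mu> = (\<Sum>\<beta>\<in>?W. if strip p \<beta> \<mu> \<and> weight \<beta> + k = weight \<mu> then u \<beta> else 0)"
    if "\<mu> \<in> ?W" for p k \<mu> and u :: "composition \<Rightarrow> 'a"
    unfolding grow_def using that
    by (simp add: sum.inter_filter[OF fin, symmetric]) (rule sum.cong, auto)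
  have "grow False (n - k) (grow True k v) \<alpha> =
      (\<Sum>\<mu>\<in>?W. \<Sum>\<beta>\<in>?W. if ?s \<beta> \<mu> \<and> weight \<beta> + k = weight \<mu> \<and> weight \<mu> + (n - k) = weight \<alpha>
        then v \<beta> else 0)" for k
    unfolding grow_W[of \<alpha>, simplified] by (intro sum.cong refl) (auto simp: grow_W intro!: sum.cong)
  then have "(\<Sum>k\<le>n. (-1) ^ k * grow False (n - k) (grow True k v) \<alpha>) =
      (\<Sum>k\<le>n. \<Sum>\<mu>\<in>?W. \<Sum>\<beta>\<in>?W. (-1) ^ k *
        (if ?s \<beta> \<mu> \<and> weight \<beta> + k = weight \<mu> \<and> weight \<mu> + (n - k) = weight \<alpha> then v \<beta> else 0))"
    by (simp add: sum_distrib_left)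
  also have "\<dots> = (\<Sum>\<beta>\<in>?W. \<Sum>\<mu>\<in>?W. \<Sum>k\<le>n. (-1) ^ k *
        (if ?s \<beta> \<mu> \<and> weight \<beta> + k = weight \<mu> \<and> weight \<mu> + (n - k) = weight \<alpha> then v \<beta> else 0))"
    by (subst sum.swap, subst sum.swap[of _ ?W ?W], rule sum.cong[OF refl], rule sum.swap)
  also have "\<dots> = (\<Sum>\<beta>\<in>?W. \<Sum>\<mu>\<in>?W. if ?s \<beta> \<mu> \<and> weight \<beta> + n = weight \<alpha>
      then (-1) ^ (weight \<beta> + weight \<mu>) * v \<beta> else 0)"
  proof (intro sum.cong refl)
    fix \<beta> \<mu>
    let ?c = "\<lambda>k. ?s \<beta> \<mu> \<and> weight \<beta> + k = weight \<mu> \<and> weight \<mu> + (n - k) = weight \<alpha>"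
    let ?k = "weight \<mu> - weight \<beta>"
    show "(\<Sum>k\<le>n. (-1) ^ k * (if ?c k then v \<beta> else 0)) =
        (if ?s \<beta> \<mu> \<and> weight \<beta> + n = weight \<alpha> then (-1) ^ (weight \<beta> + weight \<mu>) * v \<beta> else 0)"
    proof (cases "?s \<beta> \<mu> \<and> weight \<beta> + n = weight \<alpha>")
      case True
      then have le: "weight \<beta> \<le> weight \<mu>" "weight \<mu> \<le> weight \<alpha>"
        using strip_contained contained_weight by blast+
      \<comment> \<open>The weights of \<beta> and \<mu> determine \<open>k\<close>, so at most one
        summand survives.\<close>
      have "(\<Sum>k\<le>n. (-1) ^ k * (if ?c k then v \<beta> else 0)) =
          (\<Sum>k\<le>n. if k = ?k then (-1) ^ k * v \<beta> else 0)"
        using True le by (intro sum.cong) auto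
      also have "\<dots> = (-1) ^ ?k * v \<beta>"
        using True le by auto
      also have "(-1) ^ ?k = ((-1) ^ (weight \<beta> + weight \<mu>) :: 'a)"
      proof -
        have "even ?k \<longleftrightarrow> even (weight \<beta> + weight \<mu>)" using le(1) by auto
        then show ?thesis by (simp add: minus_one_power_iff)
      qed
      finally show ?thesis using True by simp
    next
      case False
      have "(\<Sum>k\<le>n. (-1) ^ k * (if ?c k then v \<beta> else 0)) = 0"
      proof (rule sum.neutral, rule ballI)
        fix k assume "k \<in> {..n}"
        with False have "\<not> ?c k" by auto
        then show "(-1) ^ k * (if ?c k then v \<beta> else 0) = 0"
          by (simp only: if_False mult_zero_right)
      qed
      with False show ?thesis by (simp only: if_False)
    qed
  qed
  also have "\<dots> = 0"
  proof (rule sum.neutral, rule ballI)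
    fix \<beta>
    show "(\<Sum>\<mu>\<in>?W. if ?s \<beta> \<mu> \<and> weight \<beta> + n = weight \<alpha>
      then (-1) ^ (weight \<beta> + weight \<mu>) * v \<beta> else 0) = 0"
    proof (cases "weight \<beta> + n = weight \<alpha>")
      case True
      then have "\<alpha> \<noteq> \<beta>" using assms by auto
      have "{\<mu> \<in> ?W. ?s \<beta> \<mu>} = {\<mu>. ?s \<beta> \<mu>}"
        using strip_contained contained_weight by blast
      then have "(\<Sum>\<mu>\<in>?W. if ?s \<beta> \<mu> then (-1) ^ (weight \<beta> + weight \<mu>) * v \<beta> else 0) =
          (\<Sum>\<mu> | ?s \<beta> \<mu>. (-1) ^ (weight \<beta> + weight \<mu>) * v \<beta>)"
        by (simp add: sum.inter_filter[OF fin, symmetric])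
      also have "\<dots> = (-1) ^ weight \<beta> * v \<beta> * of_int (\<Sum>\<mu> | ?s \<beta> \<mu>. (-1) ^ weight \<mu>)"
        by (simp add: sum_distrib_left power_add mult_ac)
      also have "\<dots> = 0"
        using signed_strip_sum[OF \<open>\<alpha> \<noteq> \<beta>\<close>] by simp
      finally show ?thesis using True by simp
    qed simp
  qed
  finally show ?thesis .
qed

section \<open>Solving the relation for its extreme terms\<close>

lemma grow_cong:
  assumes "\<And>\<mu>. strip p \<mu> \<alpha> \<Longrightarrow> weight \<mu> + n = weight \<alpha> \<Longrightarrow> u \<mu> = v \<mu>"
  shows "grow p n u \<alpha> = grow p n v \<alpha>"
  unfolding grow_def by (rule sum.cong) (use assms in auto)

lemma grow_zero [simp]: "grow p 0 v = v"
proof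
  fix \<alpha>
  have "strip p \<alpha> \<alpha>" by (cases p) (simp_all add: strip_def)
  then have "{\<mu>. strip p \<mu> \<alpha> \<and> weight \<mu> = weight \<alpha>} = {\<alpha>}"
    by (auto dest: strip_contained contained_weight_eq)
  then show "grow p 0 v \<alpha> = v \<alpha>" by (simp add: grow_def)
qed

text \<open>The term \<open>k = n\<close> of \<open>grow_relation\<close> is isolated, using that
  \<open>grow False 0\<close> is the identity.\<close>

lemma grow_True_eq:
  assumes "0 < n"
  shows "grow True n v \<alpha> =
    - (\<Sum>k<n. (-1) ^ (n - k) * grow False (n - k) (grow True k v) \<alpha> :: 'a::comm_ring_1)"
proof -
  let ?G = "\<lambda>k. grow False (n - k) (grow True k v) \<alpha> :: 'a"
  have "(-1) ^ n * grow True n v \<alpha> = - (\<Sum>k<n. (-1) ^ k * ?G k)"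
    using grow_relation[OF assms, of v \<alpha>]
    by (simp add: atMost_Suc_eq_insert_0 lessThan_Suc_atMost[symmetric] add_eq_0_iff2 add.commute
        flip: lessThan_Suc_atMost)
  then have "(-1) ^ n * ((-1) ^ n * grow True n v \<alpha>) = - (\<Sum>k<n. (-1) ^ n * ((-1) ^ k * ?G k))"
    by (simp add: sum_distrib_left)
  also have "(\<Sum>k<n. (-1) ^ n * ((-1) ^ k * ?G k)) = (\<Sum>k<n. (-1) ^ (n - k) * ?G k)"
    by (rule sum.cong) (auto simp: minus_one_power_iff)
  finally show ?thesis
    by (simp add: minus_one_power_iff split: if_splits)
qed


section \<open>Surjectivity\<close>

definition submodule :: "(composition \<Rightarrow> 'a::comm_ring_1) set \<Rightarrow> bool" where
  "submodule I \<longleftrightarrow> (\<lambda>_. 0) \<in> I \<and> (\<forall>u\<in>I. \<forall>v\<in>I. \<forall>c. (\<lambda>\<alpha>. u \<alpha> + c * v \<alpha>) \<in> I)"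

lemma submodule_add_scaled:
  "submodule I \<Longrightarrow> u \<in> I \<Longrightarrow> v \<in> I \<Longrightarrow> (\<lambda>\<alpha>. u \<alpha> + c * v \<alpha>) \<in> I"
  by (simp add: submodule_def)

lemma submodule_sum:
  assumes "submodule I" "finite A" "\<And>i. i \<in> A \<Longrightarrow> v i \<in> I"
  shows "(\<lambda>\<alpha>. \<Sum>i\<in>A. c i * v i \<alpha>) \<in> I"
  using assms(2,3)
proof induction
  case empty
  then show ?case using assms(1) by (simp add: submodule_def)
next
  case (insert i A)
  then have "(\<lambda>\<alpha>. (\<Sum>i\<in>A. c i * v i \<alpha>) + c i * v i \<alpha>) \<in> I"
    using assms(1) by (simp add: submodule_def)
  with insert show ?case by (simp add: add.commute)
qed

text \<open>Solving \<open>grow_relation\<close> for its term \<open>k = 0\<close> expresses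
  \<open>grow False n v\<close> by operators \<open>grow False (n - k)\<close> with
  \<open>k > 0\<close> applied to elements of \<open>I\<close>; this is an induction on
  \<open>n\<close> with \<open>v\<close> arbitrary.\<close>

lemma grow_False_closed:
  assumes sub: "submodule I" and T: "\<And>n v. v \<in> I \<Longrightarrow> grow True n v \<in> I" and "v \<in> I"
  shows "grow False n v \<in> I"
  using \<open>v \<in> I\<close>
proof (induction n arbitrary: v rule: less_induct)
  case (less n)
  show ?case
  proof (cases "n = 0")
    case False
    have "grow False (n - k) (grow True k v) \<in> I" if "k \<in> {1..n}" for k
      using that False by (intro less.IH T less.prems) auto
    then have "(\<lambda>\<alpha>. \<Sum>k\<in>{1..n}. (-1) ^ Suc k * grow False (n - k) (grow True k v) \<alpha>) \<in> I"
      by (intro submodule_sum sub) auto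
    moreover have "{..n} = insert 0 {1..n}" by auto
    then have "grow False n v \<alpha> = (\<Sum>k\<in>{1..n}. (-1) ^ Suc k * grow False (n - k) (grow True k v) \<alpha>)" for \<alpha>
      using grow_relation[of n v \<alpha>] False by (simp add: sum_negf add_eq_0_iff2)
    ultimately show ?thesis by (simp add: fun_eq_iff)
  qed (use less in simp)
qed

text \<open>Removing the last row of \<alpha> leaves a composition containing \<beta>, so the last
  row has at most \<open>a\<close> cells, and exactly \<open>a\<close> only for the excluded
  \<alpha>.\<close>

lemma last_row_less:
  assumes s: "strip False \<beta> \<alpha>" and w: "weight \<alpha> = weight \<beta> + a" and "0 < a"
    and ne: "\<alpha> \<noteq> \<beta> + single_row a" and l: "len \<beta> < len \<alpha>"
  obtains \<beta>' a' where "0 < a'" "a' < a" "\<alpha> = \<beta>' + single_row a'" "len \<beta>' = len \<beta>"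
proof (cases \<alpha> rule: composition_snoc_cases)
  case zero
  then show ?thesis using l by simp
next
  case (snoc \<beta>' a')
  have len: "len \<beta>' = len \<beta>"
    using s l snoc by (simp add: strip_def)
  have "rowlen \<beta> i \<le> rowlen \<beta>' i" for i
  proof (cases "i < len \<beta>")
    case True
    then show ?thesis
      using strip_contained[OF s] snoc rowlen_snoc[of a' \<beta>' i] len by (auto simp: contained_iff dest: spec[of _ i])
  qed (simp add: rowlen_def)
  then have c: "contained \<beta> \<beta>'" by (simp add: contained_iff)
  have "a' < a"
  proof (rule ccontr)
    assume "\<not> a' < a"
    then have "weight \<beta> = weight \<beta>'" "a' = a"
      using contained_weight[OF c] w snoc by auto
    then show False using contained_weight_eq[OF c] ne snoc by simp
  qed
  then show ?thesis using that snoc len by blast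
qed

lemma strip_snoc: "0 < n \<Longrightarrow> strip False \<beta> (\<beta> + single_row n)"
  by (simp add: strip_def contained_def) (simp add: part_def len_def nth_append)

text \<open>Triangularity: \<open>grow False a (point \<beta>)\<close> is the sum of the points of
  all strips of size \<open>a\<close> on \<beta>. Apart from \<open>\<beta> + single_row a\<close>
  these have fewer rows or a shorter last row, so induction on length and then on the last row
  isolates that point.\<close>

lemma point_in_submodule:
  fixes I :: "(composition \<Rightarrow> 'a::comm_ring_1) set"
  assumes sub: "submodule I" and zero: "point 0 \<in> I"
    and F: "\<And>n v. v \<in> I \<Longrightarrow> grow False n v \<in> I"
  shows "point \<alpha> \<in> I"
proof (induction "len \<alpha>" arbitrary: \<alpha> rule: less_induct)
  case (less \<alpha>)
  \<comment> \<open>In the inner induction \<beta> must vary: the smaller cases have another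
    composition below their last row.\<close>
  have inner: "point (\<beta> + single_row a) \<in> I" if "0 < a" "Suc (len \<beta>) = len \<alpha>" for \<beta> a
    using that
  proof (induction a arbitrary: \<beta> rule: less_induct)
    case (less a)
    let ?\<alpha> = "\<beta> + single_row a"
    let ?A = "{\<alpha>'. strip False \<beta> \<alpha>' \<and> weight \<alpha>' = weight \<beta> + a}"
    have fin: "finite ?A"
      by (rule finite_subset[OF _ finite_compositions[of "weight \<beta> + a"]]) auto
    have mem: "?\<alpha> \<in> ?A"
      using less.prems by (simp add: strip_snoc)
    have "point \<alpha>' \<in> I" if \<alpha>': "\<alpha>' \<in> ?A - {?\<alpha>}" for \<alpha>'
    proof (cases "len \<beta> < len \<alpha>'")
      case True
      have "strip False \<beta> \<alpha>'" "weight \<alpha>' = weight \<beta> + a" "\<alpha>' \<noteq> ?\<alpha>"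
        using \<alpha>' by auto
      then obtain \<beta>' a' where "0 < a'" "a' < a" "\<alpha>' = \<beta>' + single_row a'" "len \<beta>' = len \<beta>"
        using less.prems(1) True by (elim last_row_less)
      then show ?thesis using less by simp
    next
      case False
      then show ?thesis
        using less.prems \<open>\<And>\<alpha>'. len \<alpha>' < len \<alpha> \<Longrightarrow> point \<alpha>' \<in> I\<close> by simp
    qed
    then have 1: "(\<lambda>\<gamma>. \<Sum>\<alpha>'\<in>?A - {?\<alpha>}. 1 * point \<alpha>' \<gamma>) \<in> I"
      using fin by (intro submodule_sum sub) auto
    have "point \<beta> \<in> I"
      using \<open>\<And>\<alpha>'. len \<alpha>' < len \<alpha> \<Longrightarrow> point \<alpha>' \<in> I\<close> less.prems by simp
    then have 2: "grow False a (point \<beta>) \<in> I" by (rule F)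
    have "grow False a (point \<beta>) \<gamma> + (-1) * (\<Sum>\<alpha>'\<in>?A - {?\<alpha>}. 1 * point \<alpha>' \<gamma>) = (point ?\<alpha> \<gamma> :: 'a)" for \<gamma>
    proof -
      have "grow False a (point \<beta>) \<gamma> = (if \<gamma> \<in> ?A then 1 else 0 :: 'a)"
        by (simp add: grow_def point_def sum.inter_filter[symmetric] finite_strips)
      moreover have "(\<Sum>\<alpha>'\<in>?A - {?\<alpha>}. point \<alpha>' \<gamma>) = (if \<gamma> \<in> ?A - {?\<alpha>} then 1 else 0 :: 'a)"
        unfolding point_def using fin by (subst sum.delta') auto
      ultimately show ?thesis using mem by (auto simp: point_def)
    qed
    moreover have "(\<lambda>\<gamma>. grow False a (point \<beta>) \<gamma> + (-1) * (\<Sum>\<alpha>'\<in>?A - {?\<alpha>}. 1 * point \<alpha>' \<gamma>)) \<in> I"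
      by (rule submodule_add_scaled[OF sub 2 1])
    ultimately show ?case by (simp only:)
  qed
  show ?case
  proof (cases \<alpha> rule: composition_snoc_cases)
    case zero
    then show ?thesis using assms(2) by simp
  next
    case (snoc \<beta> n)
    then show ?thesis using inner[of n \<beta>] by simp
  qed
qed

section \<open>Existence of dual elements\<close>

lemma submodule_pairings: "submodule (range (\<lambda>f \<alpha>. pairing f (straight_series p \<alpha>)))"
proof -
  have "(\<lambda>\<alpha>. pairing f (straight_series p \<alpha>) + c * pairing g (straight_series p \<alpha>)) =
      (\<lambda>\<alpha>. pairing (f + Poly_Mapping.map ((*) c) g) (straight_series p \<alpha>))" for f g :: "'a nsym" and c
  proof
    fix \<alpha>
    have "Poly_Mapping.lookup (f + Poly_Mapping.map ((*) c) g) \<gamma> =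
        Poly_Mapping.lookup f \<gamma> + c * Poly_Mapping.lookup g \<gamma>" for \<gamma>
      by (simp add: lookup_add Poly_Mapping.map.rep_eq when_def)
    then show "pairing f (straight_series p \<alpha>) + c * pairing g (straight_series p \<alpha>) =
        pairing (f + Poly_Mapping.map ((*) c) g) (straight_series p \<alpha>)"
      by (simp add: pairing_straight_series sum_distrib_left sum.distrib algebra_simps)
  qed
  moreover have "(\<lambda>_. 0) = (\<lambda>\<alpha>. pairing (0 :: 'a nsym) (straight_series p \<alpha>))"
    by (simp add: pairing_def)
  ultimately show ?thesis
    unfolding submodule_def by (auto intro: rangeI)
qed

lemma ex_dual:
  "\<exists>f :: 'a::comm_ring_1 nsym. \<forall>\<alpha>. pairing f (straight_series p \<alpha>) = point \<beta> \<alpha>"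
proof -
  let ?\<Phi> = "\<lambda>(f :: 'a nsym) \<alpha>. pairing f (straight_series p \<alpha>)"
  have "grow p n (?\<Phi> f) = ?\<Phi> (f * complete (single_row n))" if "0 < n" for n f
    using that pairing_mult_complete[of f "single_row n" p] by simp
  \<comment> \<open>The case \<open>n = 0\<close> is separate because \<open>single_row\<close>
    yields a row only for positive \<open>n\<close>.\<close>
  then have closed: "grow p n v \<in> range ?\<Phi>" if "v \<in> range ?\<Phi>" for n v
    using that by (cases "n = 0") auto
  have "?\<Phi> (complete 0) = point 0"
    by (rule ext) (simp add: pairing_def complete_def lookup_monomial_coeffs)
  then have zero: "point 0 \<in> range ?\<Phi>"
    using rangeI[of ?\<Phi> "complete 0"] by (simp only:)
  have "grow False n v \<in> range ?\<Phi>" if "v \<in> range ?\<Phi>" for n v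
  proof (cases p)
    case True
    then show ?thesis using closed that by (intro grow_False_closed submodule_pairings) auto
  qed (use closed that in auto)
  then have "point \<beta> \<in> range ?\<Phi>"
    by (rule point_in_submodule[OF submodule_pairings zero])
  then obtain f where f: "point \<beta> = ?\<Phi> f" by (rule imageE)
  have "pairing f (straight_series p \<alpha>) = point \<beta> \<alpha>" for \<alpha>
    unfolding f ..
  then show ?thesis by blast
qed


section \<open>Injectivity\<close>

text \<open>Evaluation at \<open>\<mu> + single_row n\<close> yields \<open>v n \<mu>\<close> plus
  values at pairs that precede (\<mu>, n) in the measure and vanish by induction.\<close>

lemma grow_False_injective:
  fixes v :: "nat \<Rightarrow> composition \<Rightarrow> 'a::comm_ring_1"
  assumes zero: "\<And>\<alpha>. \<alpha> \<noteq> 0 \<Longrightarrow> (\<Sum>n=1..weight \<alpha>. grow False n (v n) \<alpha>) = 0"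
    and "0 < n"
  shows "v n \<mu> = 0"
  using \<open>0 < n\<close>
proof (induction "(\<mu>, n)" arbitrary: \<mu> n rule: wf_induct_rule[OF wf_measures
      [of "[\<lambda>(\<mu>, n). weight \<mu> + n - len \<mu>, \<lambda>(\<mu>, n). weight \<mu>]"]])
  case less: 1
  let ?\<alpha> = "\<mu> + single_row n"
  let ?S = "\<lambda>m. {\<mu>'. strip False \<mu>' ?\<alpha> \<and> weight \<mu>' + m = weight ?\<alpha>}"
  have mem: "\<mu> \<in> ?S n"
    using less.prems by (simp add: strip_snoc)
  \<comment> \<open>If the lengths agree, \<mu>' is properly contained in \<mu>, so the first
    measure is constant and the weight drops. If \<mu>' has one row more, the first measure drops;
    \<open>len_le_weight\<close> keeps its subtraction exact.\<close>
  have other: "v m \<mu>' = 0" if "\<mu>' \<in> ?S m" "\<mu>' \<noteq> \<mu>" "0 < m" for m \<mu>'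
  proof -
    have c: "contained \<mu>' ?\<alpha>" and w: "weight \<mu>' + m = weight \<mu> + n"
      and l: "len \<mu>' = len \<mu> \<or> len \<mu>' = Suc (len \<mu>)"
      using that less.prems contained_len[of \<mu>' ?\<alpha>] by (auto simp: strip_def)
    show ?thesis
    proof (cases "len \<mu>' = len \<mu>")
      case True
      have "rowlen \<mu>' i \<le> rowlen \<mu> i" for i
        using c less.prems True rowlen_snoc[of n \<mu> i] rowlen_pos_iff[of \<mu>' i]
        by (cases "i < len \<mu>") (auto simp: contained_iff dest: spec[of _ i])
      then have "contained \<mu>' \<mu>" by (simp add: contained_iff)
      then have "weight \<mu>' < weight \<mu>"
        using that(2) contained_weight contained_weight_eq by (metis le_neq_implies_less)
      then show ?thesis
        using that(3) w True by (intro less.hyps) simp_all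
    next
      case False
      then have "weight \<mu>' + m - len \<mu>' < weight \<mu> + n - len \<mu>"
        using l w len_le_weight[of \<mu>] less.prems by auto
      then show ?thesis
          using that(3) by (intro less.hyps) simp_all
    qed
  qed
  have "?\<alpha> \<noteq> 0"
    using less.prems by (simp flip: len_eq_0_iff)
  then have "0 = (\<Sum>m=1..weight ?\<alpha>. grow False m (v m) ?\<alpha>)"
    by (rule zero[symmetric])
  also have "\<dots> = (\<Sum>m=1..weight ?\<alpha>. if m = n then v n \<mu> else 0)"
  proof (rule sum.cong)
    fix m assume m: "m \<in> {1..weight ?\<alpha>}"
    have "grow False m (v m) ?\<alpha> = (\<Sum>\<mu>'\<in>?S m. if \<mu>' = \<mu> then v m \<mu> else 0)"
      unfolding grow_def using other m by (intro sum.cong) auto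
    also have "\<dots> = (if \<mu> \<in> ?S m then v m \<mu> else 0)"
      by (simp add: finite_strips del: mem_Collect_eq)
    also have "\<mu> \<in> ?S m \<longleftrightarrow> m = n"
      using mem by auto
    finally show "grow False m (v m) ?\<alpha> = (if m = n then v n \<mu> else 0)" by simp
  qed simp
  also have "\<dots> = v n \<mu>"
    using less.prems by simp
  finally show ?case by simp
qed

text \<open>Substituting \<open>grow_True_eq\<close> and collecting terms by the outer operator
  turns the relation into one for \<open>grow False\<close> with coefficients \<open>w j\<close>,
  which therefore vanish. Since \<open>w\<close> is unitriangular in \<open>v\<close> up to sign,
  \<open>v\<close> vanishes too.\<close>

lemma grow_True_injective:
  fixes v :: "nat \<Rightarrow> composition \<Rightarrow> 'a::comm_ring_1"
  assumes zero: "\<And>\<alpha>. \<alpha> \<noteq> 0 \<Longrightarrow> (\<Sum>n=1..weight \<alpha>. grow True n (v n) \<alpha>) = 0"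
    and "0 < n"
  shows "v n \<mu> = 0"
proof -
  \<comment> \<open>Beyond the weight of \<mu> no strip fits, so the cutoff makes the sum finite
    without changing it.\<close>
  define w where "w j \<mu> = (\<Sum>k\<le>weight \<mu>. (-1) ^ j * grow True k (v (j + k)) \<mu>)" for j \<mu>
  have "(\<Sum>j=1..weight \<alpha>. grow False j (w j) \<alpha>) = 0" if "\<alpha> \<noteq> 0" for \<alpha>
  proof -
    let ?N = "weight \<alpha>"
    let ?g = "\<lambda>j k. (-1) ^ j * grow False j (grow True k (v (j + k))) \<alpha>"
    have "grow False j (w j) \<alpha> = (\<Sum>k\<le>?N - j. ?g j k)" for j
    proof -
      have "grow False j (w j) \<alpha> =
          grow False j (\<lambda>\<mu>. \<Sum>k\<le>?N - j. (-1) ^ j * grow True k (v (j + k)) \<mu>) \<alpha>"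
        by (rule grow_cong) (auto simp: w_def intro!: sum.cong)
      then show ?thesis by (simp only: grow_sum)
    qed
    then have "(\<Sum>j=1..?N. grow False j (w j) \<alpha>) = (\<Sum>(j, k)\<in>Sigma {1..?N} (\<lambda>j. {..?N - j}). ?g j k)"
      by (simp add: sum.Sigma)
    \<comment> \<open>New index \<open>n = j + k\<close>, the total size added by both
      strips.\<close>
    also have "\<dots> = (\<Sum>(n, k)\<in>Sigma {1..?N} (\<lambda>n. {..<n}). ?g (n - k) k)"
      by (rule sum.reindex_bij_witness[of _ "\<lambda>(n, k). (n - k, k)" "\<lambda>(j, k). (j + k, k)"]) auto
    also have "\<dots> = (\<Sum>n=1..?N. \<Sum>k<n. ?g (n - k) k)"
      by (rule sum.Sigma[symmetric]) auto
    also have "\<dots> = (\<Sum>n=1..?N. - grow True n (v n) \<alpha>)"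
      by (intro sum.cong refl) (simp add: grow_True_eq)
    also have "\<dots> = 0"
      using zero[OF that] by (simp add: sum_negf)
    finally show ?thesis .
  qed
  then have w0: "w j \<mu> = 0" if "0 < j" for j \<mu>
    using grow_False_injective[of w j \<mu>] that by blast
  show ?thesis
    using \<open>0 < n\<close>
  proof (induction "weight \<mu>" arbitrary: n \<mu> rule: less_induct)
    case less
    \<comment> \<open>Removing a nonempty strip lowers the weight, so the induction hypothesis kills
      every term but \<open>k = 0\<close>.\<close>
    have "grow True k (v (n + k)) \<mu> = 0" if "k \<noteq> 0" for k
      unfolding grow_def using that less by (intro sum.neutral) auto
    then have "w n \<mu> = (\<Sum>k\<le>weight \<mu>. if k = 0 then (-1) ^ n * v n \<mu> else 0)"
      unfolding w_def by (intro sum.cong) auto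
    then have "(-1) ^ n * v n \<mu> = 0"
      using w0[OF less.prems] by simp
    then show ?case by (simp add: minus_one_power_iff split: if_splits)
  qed
qed

section \<open>Uniqueness and the expansion of skew functions\<close>

lemma kostka_sum_snoc:
  assumes "\<alpha> \<noteq> 0"
  shows "(\<Sum>\<gamma> | weight \<gamma> = weight \<alpha>. c \<gamma> * kostka p \<gamma> \<alpha>) =
    (\<Sum>n=1..weight \<alpha>. grow p n
      (\<lambda>\<mu>. \<Sum>\<gamma> | weight \<gamma> = weight \<mu>. c (\<gamma> + single_row n) * kostka p \<gamma> \<mu>) \<alpha> :: 'a::comm_ring_1)"
proof -
  let ?N = "weight \<alpha>"
  let ?X = "Sigma {1..?N} (\<lambda>n. {\<gamma>. weight \<gamma> = ?N - n})"
  let ?h = "\<lambda>(n, \<gamma>). \<gamma> + single_row n"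
  have bij: "bij_betw ?h ?X {\<gamma>. weight \<gamma> = ?N}"
    unfolding bij_betw_def
  proof
    show "inj_on ?h ?X"
      by (auto simp: inj_on_def snoc_eq_iff)
    have "\<gamma> \<in> ?h ` ?X" if "weight \<gamma> = ?N" for \<gamma>
    proof (cases \<gamma> rule: composition_snoc_cases)
      case zero
      then show ?thesis using that assms weight_eq_0_iff[of \<alpha>] by simp
    next
      case (snoc \<beta> n)
      then have "(n, \<beta>) \<in> ?X" using that by auto
      then have "?h (n, \<beta>) \<in> ?h ` ?X" by (rule imageI)
      then show ?thesis using snoc by simp
    qed
    then show "?h ` ?X = {\<gamma>. weight \<gamma> = ?N}" by auto
  qed
  have "(\<Sum>\<gamma> | weight \<gamma> = ?N. c \<gamma> * kostka p \<gamma> \<alpha>) =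
      (\<Sum>x\<in>?X. c (?h x) * kostka p (?h x) \<alpha>)"
    by (rule sum.reindex_bij_betw[OF bij, symmetric])
  also have "\<dots> = (\<Sum>(n, \<gamma>)\<in>?X. c (\<gamma> + single_row n) * grow p n (\<lambda>\<mu>. kostka p \<gamma> \<mu>) \<alpha>)"
    by (rule sum.cong) auto
  also have "\<dots> = (\<Sum>n=1..?N. \<Sum>\<gamma> | weight \<gamma> = ?N - n.
      c (\<gamma> + single_row n) * grow p n (\<lambda>\<mu>. kostka p \<gamma> \<mu>) \<alpha>)"
    by (simp add: sum.Sigma finite_compositions)
  also have "\<dots> = (\<Sum>n=1..?N. grow p n
      (\<lambda>\<mu>. \<Sum>\<gamma> | weight \<gamma> = weight \<mu>. c (\<gamma> + single_row n) * kostka p \<gamma> \<mu>) \<alpha>)"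
    unfolding grow_sum[symmetric]
    by (intro sum.cong refl grow_cong) (auto intro!: sum.cong)
  finally show ?thesis .
qed

text \<open>Sorted by last part, a relation between rows of the Kostka matrix is one between the
  operators \<open>grow p n\<close>. Their injectivity makes the coefficients with a given last part
  satisfy a relation of the same kind, so \<open>c\<close> is arbitrary in the induction.\<close>

lemma kostka_injective:
  fixes c :: "composition \<Rightarrow> 'a::comm_ring_1"
  assumes "\<And>\<alpha>. (\<Sum>\<gamma> | weight \<gamma> = weight \<alpha>. c \<gamma> * kostka p \<gamma> \<alpha>) = 0"
  shows "c \<gamma> = 0"
  using assms
proof (induction \<gamma> arbitrary: c rule: composition_snoc_induct)
  case zero
  then show ?case using zero[of 0] by (simp add: point_def)
next
  case (snoc \<beta> n)
  let ?v = "\<lambda>n \<mu>. \<Sum>\<gamma> | weight \<gamma> = weight \<mu>. c (\<gamma> + single_row n) * kostka p \<gamma> \<mu>"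
  have "(\<Sum>n=1..weight \<alpha>. grow p n (?v n) \<alpha>) = 0" if "\<alpha> \<noteq> 0" for \<alpha>
    using kostka_sum_snoc[OF that, of c p] snoc.prems[of \<alpha>] by simp
  then have "?v n \<mu> = 0" for \<mu>
    using grow_True_injective[of ?v n \<mu>] grow_False_injective[of ?v n \<mu>] snoc(1) by (cases p) simp_all
  then show ?case by (rule snoc.IH)
qed

text \<open>The definite description in \<open>dual_basis\<close> is justified by
  \<open>ex_dual\<close> for existence and by \<open>kostka_injective\<close>, applied to a
  difference of coefficients, for uniqueness.\<close>

lemma pairing_dual_basis:
  "pairing (dual_basis (straight_series p) \<beta> :: 'a::comm_ring_1 nsym) (straight_series p \<alpha>) = point \<beta> \<alpha>"
proof -
  obtain f :: "'a nsym" where f: "\<And>\<alpha>. pairing f (straight_series p \<alpha>) = point \<beta> \<alpha>"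
    using ex_dual by blast
  have "dual_basis (straight_series p) \<beta> = f"
    unfolding dual_basis_def
  proof (rule the_equality)
    show "\<forall>\<gamma>. pairing f (straight_series p \<gamma>) = (if \<beta> = \<gamma> then 1 else 0)"
      using f by (simp add: point_def)
  next
    fix g :: "'a nsym"
    assume g: "\<forall>\<gamma>. pairing g (straight_series p \<gamma>) = (if \<beta> = \<gamma> then 1 else 0)"
    have "Poly_Mapping.lookup g \<gamma> - Poly_Mapping.lookup f \<gamma> = 0" for \<gamma>
    proof (rule kostka_injective)
      fix \<alpha>
      have "pairing g (straight_series p \<alpha>) - pairing f (straight_series p \<alpha>) = 0"
        using f g by (simp add: point_def)
      then show "(\<Sum>\<gamma> | weight \<gamma> = weight \<alpha>.
          (Poly_Mapping.lookup g \<gamma> - Poly_Mapping.lookup f \<gamma>) * kostka p \<gamma> \<alpha>) = 0"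
        by (simp add: pairing_straight_series left_diff_distrib sum_subtractf)
    qed
    then show "g = f" by (intro poly_mapping_eqI) simp
  qed
  with f show ?thesis by simp
qed

text \<open>At a placed monomial of exponents \<delta> only \<gamma> = \<delta> contributes. Its
  coefficient starts the strip operators at \<open>point \<beta>\<close>, exactly as the count of
  skew tableaux does.\<close>

lemma skew_series_expansion:
  assumes "contained \<beta> \<alpha>"
  shows "(\<Sum>\<gamma> | weight \<gamma> = weight \<alpha> - weight \<beta>.
      pairing (dual_basis (straight_series p) \<beta> * complete \<gamma>) (straight_series p \<alpha>) * monomial_qsym \<gamma> m) =
    (tableau_series (skew_diagram \<alpha> \<beta>) (tableaux p (skew_diagram \<alpha> \<beta>)) m :: 'a::comm_ring_1)"
proof (cases "0 \<in> Poly_Mapping.keys m")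
  case True
  then show ?thesis
    by (simp add: monomial_qsym_0_in_keys tableau_series_0_in_keys finite_skew_diagram)
next
  case False
  then obtain "is" \<delta> where "is": "is \<in> index_seqs (len \<delta>)" and m: "m = placed is \<delta>"
    using ex_placed by blast
  let ?k = "\<lambda>\<gamma>. fold (grow p) (parts \<gamma>) (point \<beta>) \<alpha> :: 'a"
  have k: "pairing (dual_basis (straight_series p) \<beta> * complete \<gamma>) (straight_series p \<alpha>) = ?k \<gamma>" for \<gamma>
    using fun_cong[OF pairing_mult_complete[of "dual_basis (straight_series p) \<beta>" \<gamma> p], of \<alpha>]
    by (simp add: pairing_dual_basis)
  \<comment> \<open>If \<delta> has the wrong weight, it is missing from the sum, but then its
    coefficient is 0 as well.\<close>
  have "?k \<delta> = 0" if "weight \<delta> \<noteq> weight \<alpha> - weight \<beta>"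
    using that contained_weight[OF assms] by (intro fold_grow_weight) (auto simp: weight_def)
  then have "(\<Sum>\<gamma> | weight \<gamma> = weight \<alpha> - weight \<beta>. ?k \<gamma> * monomial_qsym \<gamma> m) = ?k \<delta>"
    by (simp add: m monomial_qsym_placed[OF "is"] finite_compositions if_distrib cong: if_cong)
  then show ?thesis
    by (simp add: k skew_series_placed[OF assms "is"] m)
qed

theorem theorem4p8:
  fixes \<alpha> \<beta> :: composition
  assumes "contained \<beta> \<alpha>"
  shows "(skew_dual_immaculate \<alpha> \<beta> :: 'a::comm_ring_1 series) =
           tableau_series (skew_diagram \<alpha> \<beta>) (immaculate_tableaux (skew_diagram \<alpha> \<beta>))
       \<and> (skew_row_strict_dual_immaculate \<alpha> \<beta> :: 'a series) =
           tableau_series (skew_diagram \<alpha> \<beta>) (row_strict_immaculate_tableaux (skew_diagram \<alpha> \<beta>))"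
proof -
  have eqs: "(dual_immaculate :: composition \<Rightarrow> 'a series) = straight_series False"
    "(row_strict_dual_immaculate :: composition \<Rightarrow> 'a series) = straight_series True"
    by (simp_all add: fun_eq_iff dual_immaculate_def row_strict_dual_immaculate_def
        straight_series_def immaculate_tableaux_eq row_strict_immaculate_tableaux_eq)
  show ?thesis
    by (intro conjI ext)
      (simp_all add: eqs skew_dual_immaculate_def skew_row_strict_dual_immaculate_def
        immaculate_def row_strict_immaculate_def skew_series_expansion[OF assms]
        immaculate_tableaux_eq row_strict_immaculate_tableaux_eq)
qed

end
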